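(* Let $n,t\ge1$ and $d\ge2$ be integers, and let $u=x_{i_1}x_{i_2}\cdots x_{i_d}$ and $v=x_{j_1}x_{j_2}\cdots x_{j_d}$ (indices increasing) be $t$-spread monomials of degree $d$ of $S=K[x_1,\dots,x_n]$ with $i_1=1$ and $j_1\ge2$. Let $I=(\mathcal{L}_t(u,v))$ be a completely $t$-spread lexsegment ideal of $S$ with $I\neq I_{n,d,t}$. Then the standard primary decomposition of $I$ is $$I=\bigcap_{G\in\mathcal{G}}\mathfrak{p}_{[n]\setminus G}\cap\bigcap_{p\in\mathcal{I}}\mathfrak{p}_{F_p}\cap\bigcap_{F\in\widetilde{\mathcal{F}}}\mathfrak{p}_{[n]\setminus F},$$ where: \begin{itemize} \item $F_p=[j_p]\setminus\mathrm{supp}_t(x_{j_1}x_{j_2}\cdots x_{j_{p-1}})$ for $p=1,\dots,d$; \item $\mathcal{G}=\{\mathrm{cosupp}_t(w)\cup\{1\}: x_1w\in M_{n,d,t},\ w>_{\mathrm{slex}}u/x_1\}$; \item $\mathcal{I}=[d]\setminus\{p\in[d]: |[n]\setminus F_p|=(d-1)t \text{ and } v/x_{j_p}>_{\mathrm{slex}}u/x_1\}$; \item with $\mathcal{F}=\{\mathrm{supp}_t(w): w\in M_{n+1-t,d-1,t},\ w>_{\mathrm{slex}}v/x_{\max(v)}\}$, $\widetilde{\mathcal{F}}$ is the family of those sets $F=\mathrm{supp}_t(w)\in\mathcal{F}$, $w=x_{\ell_1}\cdots x_{\ell_{d-1}}$, such that either $1\notin F$ and $x_{\ell_1+(t-1)}\cdots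 x_{\ell_{d-1}+(t-1)}\le_{\mathrm{slex}}u/x_1$, or $1\in F$ and $F\cup\{j\}\notin\mathcal{G}$ for all $j\notin F$. \end{itemize}
   Context: $S=K[x_1,\dots,x_n]$ is a polynomial ring over a field $K$, and $[m]=\{1,\dots,m\}$. For integers $a,b$, $[a,b]=\{\ell: a\le\ell\le b\}$. For a monomial $w$, $\max(w)$ and $\min(w)$ are the largest and smallest index of a variable dividing $w$. For $t\ge1$, a monomial $x_{i_1}\cdots x_{i_d}$ with $i_1\le\dots\le i_d$ is $t$-spread if $i_{r+1}-i_r\ge t$ for $r=1,\dots,d-1$. $M_{m,d,t}$ is the set of $t$-spread monomials of degree $d$ in the variables $x_1,\dots,x_m$, and $I_{n,d,t}$ (the $t$-spread Veronese ideal of degree $d$) is the ideal of $S$ generated by $M_{n,d,t}$. For squarefree monomials of the same degree, $x_{i_1}\cdots x_{i_d}>_{\mathrm{slex}}x_{j_1}\cdots x_{j_d}$ (indices increasing) if for some $s$ one has $i_1=j_1,\dots,i_{s-1}=j_{s-1}$ and $i_s<j_s$. For $u\ge_{\mathrm{slex}}v$ in $M_{n,d,t}$: $\mathcal{L}_t(u,v)=\{w\in M_{n,d,t}: u\ge_{\mathrm{slex}}w\ge_{\mathrm{slex}}v\}$, $\mathcal{L}_t^i(v)=\{w\in M_{n,d,t}: w\ge_{\mathrm{slex}}v\}$, $\mathcal{L}_t^f(u)=\{w\in M_{n,d,t}: w\le_{\mathrm{slex}}u\}$; parentheses denote the generated ideal. The ideal $I=(\mathcal{L}_t(u,v))$ is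 a completely $t$-spread lexsegment ideal if $I=(\mathcal{L}_t^i(v))\cap(\mathcal{L}_t^f(u))$. For a $t$-spread monomial $w=x_{\ell_1}\cdots x_{\ell_k}$: if $\max(w)\le n+1-t$, $\mathrm{supp}_t(w)=\bigcup_{r=1}^k[\ell_r,\ell_r+(t-1)]$; if $\min(w)\ge t$, $\mathrm{cosupp}_t(w)=\bigcup_{r=1}^k[\ell_r-(t-1),\ell_r]$; and $\mathrm{supp}_t(1)=\mathrm{cosupp}_t(1)=\emptyset$. For $A\subseteq[n]$, $\mathfrak{p}_A=(x_i:i\in A)$. The standard primary decomposition of a squarefree monomial ideal $I$ is its unique minimal (irredundant) primary decomposition $I=\bigcap_{\mathfrak{p}\in\mathrm{Min}(I)}\mathfrak{p}$, where $\mathrm{Min}(I)$ is the set of minimal primes of $I$.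
   Formalization: In the definition of 𝓘 the condition v/x_{j_p} >_slex u/x_1 is replaced by x_{j_1+(t-1)}⋯x_{j_{p-1}+(t-1)}x_{j_{p+1}}⋯x_{j_d} >_slex u/x_1; as printed the claim fails, e.g. for n=5, t=d=2, u=x_1x_3, v=x_2x_5. *)

theory Defs
  imports "HOL-Algebra.Ideal" "HOL-Library.Poly_Mapping"
begin

section \<open>Minimal primary decompositions\<close>

definition radical_of :: "('a, 'b) ring_scheme \<Rightarrow> 'a set \<Rightarrow> 'a set" where
  "radical_of R Q = {a \<in> carrier R. \<exists>k::nat. a [^]\<^bsub>R\<^esub> k \<in> Q}"

definition primary_ideal :: "('a, 'b) ring_scheme \<Rightarrow> 'a set \<Rightarrow> bool" where
  "primary_ideal R Q \<longleftrightarrow> ideal Q R \<and> Q \<noteq> carrier R \<and>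
     (\<forall>a \<in> carrier R. \<forall>b \<in> carrier R. a \<otimes>\<^bsub>R\<^esub> b \<in> Q \<longrightarrow> a \<in> Q \<or> b \<in> radical_of R Q)"

definition minimal_primes :: "('a, 'b) ring_scheme \<Rightarrow> 'a set \<Rightarrow> 'a set set" where
  "minimal_primes R I = {P. primeideal P R \<and> I \<subseteq> P \<and>
     (\<forall>P'. primeideal P' R \<and> I \<subseteq> P' \<and> P' \<subseteq> P \<longrightarrow> P' = P)}"

text \<open>Decompositions are indexed families, so that irredundancy also excludes listing the same
  component twice. The intersections are taken inside the ring, so that the empty one is the
  unit ideal.\<close>

definition family_Inter :: "('a, 'b) ring_scheme \<Rightarrow> 'i set \<Rightarrow> ('i \<Rightarrow> 'a set) \<Rightarrow> 'a set" where
  "family_Inter R J Q = carrier R \<inter> (\<Inter>i\<in>J. Q i)"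

definition minimal_primary_decomposition ::
    "('a, 'b) ring_scheme \<Rightarrow> 'a set \<Rightarrow> 'i set \<Rightarrow> ('i \<Rightarrow> 'a set) \<Rightarrow> bool" where
  "minimal_primary_decomposition R I J Q \<longleftrightarrow>
     finite J \<and> (\<forall>i\<in>J. primary_ideal R (Q i)) \<and> I = family_Inter R J Q \<and>
     inj_on (\<lambda>i. radical_of R (Q i)) J \<and> (\<forall>i\<in>J. I \<noteq> family_Inter R (J - {i}) Q)"

definition standard_primary_decomposition ::
    "('a, 'b) ring_scheme \<Rightarrow> 'a set \<Rightarrow> 'i set \<Rightarrow> ('i \<Rightarrow> 'a set) \<Rightarrow> bool" where
  "standard_primary_decomposition R I J Q \<longleftrightarrow>
     minimal_primary_decomposition R I J Q \<and> Q ` J = minimal_primes R I"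


section \<open>The polynomial ring in the variables with indices \<open>1, \<dots>, n\<close>\<close>

type_synonym 'k mpolynomial = "(nat \<Rightarrow>\<^sub>0 nat) \<Rightarrow>\<^sub>0 'k"

definition poly_ring :: "nat \<Rightarrow> ('k::field mpolynomial) ring" where
  "poly_ring n = \<lparr>carrier = {p. \<forall>m \<in> Poly_Mapping.keys p. Poly_Mapping.keys m \<subseteq> {1..n}},
     monoid.mult = (*), one = 1, zero = 0, add = (+)\<rparr>"

definition X :: "nat \<Rightarrow> 'k::field mpolynomial" where
  "X i = Poly_Mapping.single (Poly_Mapping.single i 1) 1"

definition var_prime :: "nat \<Rightarrow> nat set \<Rightarrow> 'k::field mpolynomial set" where
  "var_prime n A = Idl\<^bsub>poly_ring n\<^esub> (X ` A)"


section \<open>Spread monomials\<close>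

text \<open>The monomial with indices \<open>i\<^sub>1 \<le> \<dots> \<le> i\<^sub>d\<close> is encoded by the list of its indices in
  increasing order. Accordingly \<open>w / x\<^sub>i\<close> is \<^term>\<open>remove1 i w\<close>, and \<open>x\<^sub>1 w\<close> is \<^term>\<open>1 # w\<close>.\<close>

definition monomial :: "nat list \<Rightarrow> 'k::field mpolynomial" where
  "monomial w = (\<Prod>i\<leftarrow>w. X i)"

definition t_spread :: "nat \<Rightarrow> nat list \<Rightarrow> bool" where
  "t_spread t w \<longleftrightarrow> sorted w \<and> (\<forall>r. Suc r < length w \<longrightarrow> w ! r + t \<le> w ! Suc r)"

definition M :: "nat \<Rightarrow> nat \<Rightarrow> nat \<Rightarrow> nat list set" where
  "M m d t = {w. t_spread t w \<and> length w = d \<and> set w \<subseteq> {1..m}}"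

definition slex_gt :: "nat list \<Rightarrow> nat list \<Rightarrow> bool" (infix \<open>>slex\<close> 50) where
  "v >slex w \<longleftrightarrow> length v = length w \<and>
     (\<exists>s < length v. (\<forall>r < s. v ! r = w ! r) \<and> v ! s < w ! s)"

definition slex_ge :: "nat list \<Rightarrow> nat list \<Rightarrow> bool" (infix \<open>\<ge>slex\<close> 50) where
  "v \<ge>slex w \<longleftrightarrow> v >slex w \<or> v = w"

definition ideal_of :: "nat \<Rightarrow> nat list set \<Rightarrow> 'k::field mpolynomial set" where
  "ideal_of n L = Idl\<^bsub>poly_ring n\<^esub> (monomial ` L)"

definition veronese_ideal :: "nat \<Rightarrow> nat \<Rightarrow> nat \<Rightarrow> 'k::field mpolynomial set" where
  "veronese_ideal n d t = ideal_of n (M n d t)"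

definition lexseg :: "nat \<Rightarrow> nat \<Rightarrow> nat \<Rightarrow> nat list \<Rightarrow> nat list \<Rightarrow> nat list set" where
  "lexseg n d t u v = {w \<in> M n d t. u \<ge>slex w \<and> w \<ge>slex v}"

definition initial_lexseg :: "nat \<Rightarrow> nat \<Rightarrow> nat \<Rightarrow> nat list \<Rightarrow> nat list set" where
  "initial_lexseg n d t v = {w \<in> M n d t. w \<ge>slex v}"

definition final_lexseg :: "nat \<Rightarrow> nat \<Rightarrow> nat \<Rightarrow> nat list \<Rightarrow> nat list set" where
  "final_lexseg n d t u = {w \<in> M n d t. u \<ge>slex w}"

definition completely_lexsegment_ideal ::
    "nat \<Rightarrow> nat \<Rightarrow> nat \<Rightarrow> nat list \<Rightarrow> nat list \<Rightarrow> 'k::field mpolynomial set \<Rightarrow> bool" where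
  "completely_lexsegment_ideal n d t u v I \<longleftrightarrow>
     I = ideal_of n (lexseg n d t u v) \<and>
     I = ideal_of n (initial_lexseg n d t v) \<inter> ideal_of n (final_lexseg n d t u)"


section \<open>The index sets of the decomposition\<close>

definition supp_t :: "nat \<Rightarrow> nat list \<Rightarrow> nat set" where
  "supp_t t w = (\<Union>l \<in> set w. {l..l + (t - 1)})"

text \<open>Used only for monomials all of whose indices are at least \<open>t\<close>, so the subtraction does not
  truncate.\<close>

definition cosupp_t :: "nat \<Rightarrow> nat list \<Rightarrow> nat set" where
  "cosupp_t t w = (\<Union>l \<in> set w. {l - (t - 1)..l})"

definition shift :: "nat \<Rightarrow> nat list \<Rightarrow> nat list" where
  "shift t w = map (\<lambda>l. l + (t - 1)) w"

text \<open>Here \<open>p\<close> counts from 1 whereas list positions count from 0: \<open>j\<^sub>p\<close> is \<^term>\<open>v ! (p - 1)\<close>.\<close>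

definition F_set :: "nat \<Rightarrow> nat list \<Rightarrow> nat \<Rightarrow> nat set" where
  "F_set t v p = {1..v ! (p - 1)} - supp_t t (take (p - 1) v)"

definition G_family :: "nat \<Rightarrow> nat \<Rightarrow> nat \<Rightarrow> nat list \<Rightarrow> nat set set" where
  "G_family n d t u =
     {cosupp_t t w \<union> {1} | w. 1 # w \<in> M n d t \<and> w >slex remove1 1 u}"

text \<open>This differs from the source, which compares \<open>v / x\<^bsub>j\<^sub>p\<^esub>\<close> with \<open>u / x\<^sub>1\<close>. With that
  comparison the decomposition is false for \<open>t \<ge> 2\<close>. Take \<open>n = 5\<close>, \<open>t = d = 2\<close>,
  \<open>u = x\<^sub>1 x\<^sub>3\<close>, \<open>v = x\<^sub>2 x\<^sub>5\<close>, so that \<open>I\<close> is generated by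
  \<open>x\<^sub>1 x\<^sub>3, x\<^sub>1 x\<^sub>4, x\<^sub>1 x\<^sub>5, x\<^sub>2 x\<^sub>4, x\<^sub>2 x\<^sub>5\<close>:
  then \<open>p = 2\<close> would be dropped since \<open>x\<^sub>2\<close> precedes \<open>x\<^sub>3\<close>, although
  \<open>F\<^sub>2 = {1, 4, 5}\<close> gives a minimal prime.
  When \<open>[n] - F\<^sub>p\<close> has \<open>(d - 1) t\<close> elements it is the \<open>t\<close>-cosupport of the monomial obtained from
  \<open>v / x\<^bsub>j\<^sub>p\<^esub>\<close> by raising the indices before \<open>j\<^sub>p\<close> by \<open>t - 1\<close> (the later ones are then
  \<open>j\<^sub>p + t, j\<^sub>p + 2 t, \<dots>, n\<close>). That monomial has to be compared with \<open>u / x\<^sub>1\<close>, as in the first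
  case of \<open>F_tilde\<close> below. The two conditions agree for \<open>t = 1\<close>.\<close>

definition I_set :: "nat \<Rightarrow> nat \<Rightarrow> nat \<Rightarrow> nat list \<Rightarrow> nat list \<Rightarrow> nat set" where
  "I_set n d t u v = {1..d} -
     {p \<in> {1..d}. card ({1..n} - F_set t v p) = (d - 1) * t \<and>
        shift t (take (p - 1) v) @ drop p v >slex remove1 1 u}"

definition F_tilde :: "nat \<Rightarrow> nat \<Rightarrow> nat \<Rightarrow> nat list \<Rightarrow> nat list \<Rightarrow> nat set set" where
  "F_tilde n d t u v =
     {supp_t t w | w. w \<in> M (n + 1 - t) (d - 1) t \<and> w >slex remove1 (Max (set v)) v \<and>
        (1 \<notin> supp_t t w \<and> remove1 1 u \<ge>slex shift t w \<or>
         1 \<in> supp_t t w \<and> (\<forall>j \<in> {1..n} - supp_t t w. supp_t t w \<union> {j} \<notin> G_family n d t u))}"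

end

theory Submission
  imports Defs
begin

text \<open>A squarefree monomial ideal is the intersection of the primes generated by the complements
  of the maximal sets of variables containing no generator, and these primes are its minimal primes.
  So everything reduces to determining the maximal subsets of \<open>{1..n}\<close> that contain no
  list of \<open>lexseg n d t u v\<close>. By complete lexsegmentness such a set either contains no spread list
  \<open>\<ge>slex v\<close> or none \<open>\<le>slex u\<close>. In the first case, choosing a spread list greedily
  from the left and comparing it with \<open>v\<close> puts the set inside
  \<open>{1..n} - F_set t v p\<close> or inside a union of \<open>d - 1\<close> blocks starting at a list \<open>>slex v / x\<^sub>m\<^sub>a\<^sub>x\<close>.
  In the second case, choosing greedily from the right puts it inside a member of \<open>G_family\<close>.
  The exceptions removed in \<open>I_set\<close> and \<open>F_tilde\<close> are exactly the sets contained in a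
  member of \<open>G_family\<close>; that the remaining ones form an antichain follows by counting elements, since
  members of \<open>G_family\<close> have \<open>(d - 1) * t + 1\<close> elements and the other sets at least, respectively
  exactly, \<open>(d - 1) * t\<close>.\<close>

section \<open>Monomial ideals\<close>

lemma poly_ring_sel [simp]:
  "x \<in> carrier (poly_ring n) \<longleftrightarrow> (\<forall>m \<in> Poly_Mapping.keys x. Poly_Mapping.keys m \<subseteq> {1..n})"
  "x \<otimes>\<^bsub>poly_ring n\<^esub> y = x * y" "\<one>\<^bsub>poly_ring n\<^esub> = 1"
  "x \<oplus>\<^bsub>poly_ring n\<^esub> y = x + y" "\<zero>\<^bsub>poly_ring n\<^esub> = 0"
  by (simp_all add: poly_ring_def)

lemma keys_add_nat:
  fixes a b :: "'a \<Rightarrow>\<^sub>0 nat"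
  shows "Poly_Mapping.keys (a + b) = Poly_Mapping.keys a \<union> Poly_Mapping.keys b"
  by (auto simp: in_keys_iff lookup_add)

lemma keys_multE:
  assumes "m \<in> Poly_Mapping.keys (f * g)"
  obtains a b where "a \<in> Poly_Mapping.keys f" "b \<in> Poly_Mapping.keys g" "m = a + b"
  using keys_mult[of f g] assms by blast

lemma keys_uminus_eq [simp]:
  fixes p :: "'a \<Rightarrow>\<^sub>0 'b::ab_group_add"
  shows "Poly_Mapping.keys (- p) = Poly_Mapping.keys p"
  by (auto simp: in_keys_iff)

lemma poly_ring_mult_closed:
  assumes "x \<in> carrier (poly_ring n)" "y \<in> carrier (poly_ring n)"
  shows "x * y \<in> carrier (poly_ring n)"
proof -
  have "Poly_Mapping.keys m \<subseteq> {1..n}" if "m \<in> Poly_Mapping.keys (x * y)" for m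
    using that assms by (elim keys_multE) (simp add: keys_add_nat)
  then show ?thesis by simp
qed

lemma poly_ring_cring: "cring (poly_ring n :: 'k::field mpolynomial ring)"
proof (rule cringI)
  show "abelian_group (poly_ring n :: 'k mpolynomial ring)"
  proof (rule abelian_groupI)
    fix x assume "x \<in> carrier (poly_ring n :: 'k mpolynomial ring)"
    then show "\<exists>y\<in>carrier (poly_ring n :: 'k mpolynomial ring). y \<oplus>\<^bsub>poly_ring n\<^esub> x = \<zero>\<^bsub>poly_ring n\<^esub>"
      by (intro bexI[of _ "- x"]) auto
  next
    fix x y assume "x \<in> carrier (poly_ring n :: 'k mpolynomial ring)"
      "y \<in> carrier (poly_ring n :: 'k mpolynomial ring)"
    then show "x \<oplus>\<^bsub>poly_ring n\<^esub> y \<in> carrier (poly_ring n)"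
      using keys_add[of x y] by auto
  qed (auto simp: add_ac)
  show "comm_monoid (poly_ring n :: 'k mpolynomial ring)"
  proof (rule comm_monoidI)
    fix x y assume "x \<in> carrier (poly_ring n :: 'k mpolynomial ring)"
      "y \<in> carrier (poly_ring n :: 'k mpolynomial ring)"
    then show "x \<otimes>\<^bsub>poly_ring n\<^esub> y \<in> carrier (poly_ring n)"
      using poly_ring_mult_closed[of x n y] by (simp del: poly_ring_sel(1) add: poly_ring_sel(2))
  qed (auto simp: mult_ac)
qed (simp add: distrib_right)

lemma poly_ring_ideal_add:
  assumes "ideal Q (poly_ring n)" "a \<in> Q" "b \<in> Q"
  shows "a + b \<in> Q"
  using additive_subgroup.a_closed[OF ideal.axioms(1)[OF assms(1)] assms(2,3)] by simp

lemma poly_ring_ideal_uminus: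
  fixes Q :: "'k::field mpolynomial set"
  assumes "ideal Q (poly_ring n)" "a \<in> Q"
  shows "- a \<in> Q"
proof -
  have "(- 1) \<otimes>\<^bsub>poly_ring n\<^esub> a \<in> Q"
    by (rule ideal.I_l_closed[OF assms]) simp
  then show ?thesis by simp
qed

lemma poly_ring_ideal_sum:
  assumes "ideal Q (poly_ring n)" "\<And>x. x \<in> A \<Longrightarrow> f x \<in> Q"
  shows "sum f A \<in> Q"
  using assms(2)
proof (induction A rule: infinite_finite_induct)
  case (insert x A)
  then show ?case by (auto intro: poly_ring_ideal_add[OF assms(1)])
qed (use additive_subgroup.zero_closed[OF ideal.axioms(1)[OF assms(1)]] in auto)

text \<open>Serves two purposes: the constant predicate writes a polynomial as the sum of its terms,
  and divisibility by some variable of a given set splits off the part lying in the prime generated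
  by that set.\<close>

definition restrict_keys :: "('a \<Rightarrow> bool) \<Rightarrow> ('a \<Rightarrow>\<^sub>0 'b::comm_monoid_add) \<Rightarrow> ('a \<Rightarrow>\<^sub>0 'b)" where
  "restrict_keys P p = (\<Sum>m | m \<in> Poly_Mapping.keys p \<and> P m.
     Poly_Mapping.single m (Poly_Mapping.lookup p m))"

lemma lookup_restrict_keys:
  "Poly_Mapping.lookup (restrict_keys P p) k = (if P k then Poly_Mapping.lookup p k else 0)"
proof -
  have "Poly_Mapping.lookup (restrict_keys P p) k =
      (\<Sum>m | m \<in> Poly_Mapping.keys p \<and> P m. if m = k then Poly_Mapping.lookup p m else 0)"
    unfolding restrict_keys_def lookup_sum by (rule sum.cong) (auto simp: lookup_single when_def)
  also have "\<dots> = (if P k then Poly_Mapping.lookup p k else 0)"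
    by (auto simp: sum.delta' in_keys_iff)
  finally show ?thesis .
qed

lemma keys_restrict_keys: "Poly_Mapping.keys (restrict_keys P p) = {m \<in> Poly_Mapping.keys p. P m}"
  by (auto simp: in_keys_iff lookup_restrict_keys split: if_splits)

lemma restrict_keys_split:
  fixes p :: "'a \<Rightarrow>\<^sub>0 'b::ab_group_add"
  shows "p = restrict_keys P p + restrict_keys (\<lambda>m. \<not> P m) p"
  by (rule poly_mapping_eqI) (simp add: lookup_add lookup_restrict_keys)

lemma mem_ideal_if_terms_mem:
  fixes p :: "'k::field mpolynomial"
  assumes "ideal Q (poly_ring n)"
    and "\<And>m. m \<in> Poly_Mapping.keys p \<Longrightarrow> Poly_Mapping.single m (Poly_Mapping.lookup p m) \<in> Q"
  shows "p \<in> Q"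
proof -
  have "p = restrict_keys (\<lambda>_. True) p"
    by (rule poly_mapping_eqI) (simp add: lookup_restrict_keys)
  also have "\<dots> \<in> Q" unfolding restrict_keys_def
    by (rule poly_ring_ideal_sum[OF assms(1)]) (use assms(2) in auto)
  finally show ?thesis .
qed

text \<open>Exponents of a product are sums of exponents of the factors, so upward closure of
  \<open>U\<close> is all that absorption needs. Both the explicit form of a monomial ideal and that
  of a prime generated by variables are recognized as ideals this way.\<close>

lemma ideal_of_upclosed:
  fixes U :: "(nat \<Rightarrow>\<^sub>0 nat) \<Rightarrow> bool"
  assumes up: "\<And>m m'. U m \<Longrightarrow> U (m + m')"
  shows "ideal {p \<in> carrier (poly_ring n). \<forall>m \<in> Poly_Mapping.keys p. U m}
    (poly_ring n :: 'k::field mpolynomial ring)" (is "ideal ?J ?R")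
proof -
  interpret cring ?R by (rule poly_ring_cring)
  have l: "x \<otimes>\<^bsub>?R\<^esub> a \<in> ?J" if "a \<in> ?J" "x \<in> carrier ?R" for a x
  proof -
    have "U m" if "m \<in> Poly_Mapping.keys (x * a)" for m
      using that
    proof (rule keys_multE)
      fix b c assume "b \<in> Poly_Mapping.keys x" "c \<in> Poly_Mapping.keys a" "m = b + c"
      then show "U m" using up[of c b] \<open>a \<in> ?J\<close> by (auto simp: add.commute)
    qed
    then show ?thesis using poly_ring_mult_closed[of x n a] that by auto
  qed
  show ?thesis
  proof (rule idealI)
    show "subgroup ?J (add_monoid ?R)"
    proof (rule add.subgroupI)
      have "(0 :: 'k mpolynomial) \<in> ?J" by simp
      then show "?J \<noteq> {}" by blast
      fix a b assume *: "a \<in> ?J" "b \<in> ?J"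
      show "a \<oplus>\<^bsub>?R\<^esub> b \<in> ?J" using * keys_add[of a b]
        by (simp del: atLeastAtMost_iff atLeastatMost_subset_iff add: subset_iff) blast
      have "- a \<in> carrier ?R" using * by auto
      then have "\<ominus>\<^bsub>?R\<^esub> a = - a" by (intro minus_equality) (use * in auto)
      then show "\<ominus>\<^bsub>?R\<^esub> a \<in> ?J" using * by auto
    qed auto
    show "a \<otimes>\<^bsub>?R\<^esub> x \<in> ?J" if "a \<in> ?J" "x \<in> carrier ?R" for a x
      using l[OF that] unfolding poly_ring_sel(2) by (simp only: mult.commute)
  qed (fact ring_axioms l)+
qed

text \<open>One inclusion is minimality of the generated ideal. For the other, each term of a
  polynomial on the right is a multiple of a generator, and the polynomial is the sum of its
  terms.\<close>

lemma genideal_monomials: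
  fixes B :: "(nat \<Rightarrow>\<^sub>0 nat) set"
  assumes B: "\<And>b. b \<in> B \<Longrightarrow> Poly_Mapping.keys b \<subseteq> {1..n}"
  shows "Idl\<^bsub>poly_ring n\<^esub> ((\<lambda>b. Poly_Mapping.single b (1::'k::field)) ` B) =
    {p \<in> carrier (poly_ring n). \<forall>m \<in> Poly_Mapping.keys p. \<exists>b\<in>B. \<exists>c. m = b + c}"
    (is "Idl\<^bsub>?R\<^esub> ?X = ?J")
proof
  interpret cring ?R by (rule poly_ring_cring)
  have sub: "?X \<subseteq> carrier ?R" using B by (fastforce simp: subset_iff)
  have "ideal ?J ?R" by (rule ideal_of_upclosed) (metis add.assoc)
  moreover have "?X \<subseteq> ?J"
  proof
    fix x assume "x \<in> ?X"
    then obtain b where "b \<in> B" "x = Poly_Mapping.single b 1" by blast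
    moreover have "b = b + 0" by simp
    ultimately show "x \<in> ?J" using B[of b] by (auto intro!: bexI[of _ b])
  qed
  ultimately show "Idl\<^bsub>?R\<^esub> ?X \<subseteq> ?J" by (rule genideal_minimal)
  show "?J \<subseteq> Idl\<^bsub>?R\<^esub> ?X"
  proof
    fix p assume p: "p \<in> ?J"
    have id: "ideal (Idl\<^bsub>?R\<^esub> ?X) ?R" by (rule genideal_ideal[OF sub])
    show "p \<in> Idl\<^bsub>?R\<^esub> ?X"
    proof (rule mem_ideal_if_terms_mem[OF id])
      fix m assume m: "m \<in> Poly_Mapping.keys p"
      with p obtain b c where bc: "b \<in> B" "m = b + c" by blast
      from m p have "Poly_Mapping.keys m \<subseteq> {1..n}" by auto
      then have "Poly_Mapping.single c (Poly_Mapping.lookup p m) \<in> carrier ?R"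
        using bc by (auto simp: keys_add_nat)
      moreover have "Poly_Mapping.single b 1 \<in> Idl\<^bsub>?R\<^esub> ?X"
        using genideal_self[OF sub] bc by auto
      ultimately have "Poly_Mapping.single c (Poly_Mapping.lookup p m) \<otimes>\<^bsub>?R\<^esub>
          Poly_Mapping.single b 1 \<in> Idl\<^bsub>?R\<^esub> ?X"
        by (intro ideal.I_l_closed[OF id])
      then show "Poly_Mapping.single m (Poly_Mapping.lookup p m) \<in> Idl\<^bsub>?R\<^esub> ?X"
        by (simp add: mult_single bc add.commute)
    qed
  qed
qed

lemma monomial_eq_single:
  "monomial w = Poly_Mapping.single (\<Sum>i\<leftarrow>w. Poly_Mapping.single i 1) (1::'k::field)"
  unfolding monomial_def by (induction w) (simp_all add: X_def mult_single)

text \<open>Distinctness makes the exponent of the product the indicator function of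
  \<open>set w\<close>, so divisibility only asks for positive exponents there.\<close>

lemma exponents_divide_iff:
  fixes m :: "nat \<Rightarrow>\<^sub>0 nat"
  assumes "distinct w"
  shows "(\<exists>c. m = (\<Sum>i\<leftarrow>w. Poly_Mapping.single i 1) + c) \<longleftrightarrow> set w \<subseteq> Poly_Mapping.keys m"
proof -
  have *: "Poly_Mapping.lookup (\<Sum>i\<leftarrow>w. Poly_Mapping.single i (1::nat)) k = (if k \<in> set w then 1 else 0)" for k
    using assms by (induction w) (auto simp: lookup_add lookup_single when_def)
  show ?thesis
  proof
    assume "set w \<subseteq> Poly_Mapping.keys m"
    then have le: "Poly_Mapping.lookup m k \<ge> (if k \<in> set w then 1 else 0)" for k
      by (auto simp: in_keys_iff Suc_le_eq)
    \<comment> \<open>The quotient is the truncated difference, which is exact by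
      \<open>le\<close>.\<close>
    have "m = (\<Sum>i\<leftarrow>w. Poly_Mapping.single i 1) + (m - (\<Sum>i\<leftarrow>w. Poly_Mapping.single i 1))"
      by (intro poly_mapping_eqI) (simp only: lookup_add lookup_minus * le le_add_diff_inverse)
    then show "\<exists>c. m = (\<Sum>i\<leftarrow>w. Poly_Mapping.single i 1) + c" by blast
  qed (auto simp: keys_add_nat in_keys_iff lookup_add *[unfolded One_nat_def])
qed

text \<open>The generators are squarefree, so membership of a monomial depends only on its support.
  This is the passage from ideals to sets of variables.\<close>

lemma ideal_of_eq:
  assumes "\<And>w. w \<in> L \<Longrightarrow> distinct w \<and> set w \<subseteq> {1..n}"
  shows "(ideal_of n L :: 'k::field mpolynomial set) =
    {p \<in> carrier (poly_ring n). \<forall>m \<in> Poly_Mapping.keys p. \<exists>w\<in>L. set w \<subseteq> Poly_Mapping.keys m}"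
proof -
  have k: "Poly_Mapping.keys (\<Sum>i\<leftarrow>w. Poly_Mapping.single i (1::nat)) = set w" for w
    by (induction w) (auto simp: keys_add_nat)
  have "(ideal_of n L :: 'k mpolynomial set) =
     Idl\<^bsub>poly_ring n\<^esub> ((\<lambda>b. Poly_Mapping.single b (1::'k)) ` (\<lambda>w. \<Sum>i\<leftarrow>w. Poly_Mapping.single i 1) ` L)"
    unfolding ideal_of_def image_image monomial_eq_single ..
  also have "\<dots> = {p \<in> carrier (poly_ring n). \<forall>m \<in> Poly_Mapping.keys p.
      \<exists>w\<in>L. \<exists>c. m = (\<Sum>i\<leftarrow>w. Poly_Mapping.single i 1) + c}"
    by (subst genideal_monomials) (use assms in \<open>auto simp: k[unfolded One_nat_def] subset_iff\<close>)
  also have "\<dots> = {p \<in> carrier (poly_ring n). \<forall>m \<in> Poly_Mapping.keys p. \<exists>w\<in>L. set w \<subseteq> Poly_Mapping.keys m}"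
    using assms exponents_divide_iff by (intro Collect_cong conj_cong ball_cong bex_cong refl) auto
  finally show ?thesis .
qed

section \<open>Primes generated by variables\<close>

lemma var_prime_eq:
  assumes "A \<subseteq> {1..n}"
  shows "(var_prime n A :: 'k::field mpolynomial set) =
    {p \<in> carrier (poly_ring n). \<forall>m \<in> Poly_Mapping.keys p. Poly_Mapping.keys m \<inter> A \<noteq> {}}"
proof -
  have "(var_prime n A :: 'k mpolynomial set) = ideal_of n ((\<lambda>i. [i]) ` A)"
    unfolding var_prime_def ideal_of_def image_image by (simp add: monomial_def)
  also have "\<dots> = {p \<in> carrier (poly_ring n). \<forall>m \<in> Poly_Mapping.keys p.
      \<exists>w\<in>(\<lambda>i. [i]) ` A. set w \<subseteq> Poly_Mapping.keys m}"
    by (rule ideal_of_eq) (use assms in auto)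
  finally show ?thesis by auto
qed

text \<open>Split each factor into the terms containing a variable of \<open>A\<close> and the rest.
  If the product lies in the ideal, so does the product of the two rests; but none of its exponents
  meets \<open>A\<close>, so it is zero, and one of the rests vanishes.\<close>

lemma var_prime_primeideal:
  assumes A: "A \<subseteq> {1..n}"
  shows "primeideal (var_prime n A) (poly_ring n :: 'k::field mpolynomial ring)" (is "primeideal ?P ?R")
proof (rule primeidealI)
  let ?U = "\<lambda>m :: nat \<Rightarrow>\<^sub>0 nat. Poly_Mapping.keys m \<inter> A \<noteq> {}"
  show ideal: "ideal ?P ?R"
    unfolding var_prime_eq[OF A] by (rule ideal_of_upclosed) (auto simp: keys_add_nat)
  show "cring ?R" by (rule poly_ring_cring)
  have "1 \<in> carrier ?R" "1 \<notin> ?P" by (simp_all add: var_prime_eq[OF A])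
  then show "carrier ?R \<noteq> ?P" by metis
  fix a b assume ab: "a \<in> carrier ?R" "b \<in> carrier ?R" "a \<otimes>\<^bsub>?R\<^esub> b \<in> ?P"
  define a1 b1 a2 b2 where "a1 = restrict_keys ?U a" and "b1 = restrict_keys ?U b"
    and "a2 = restrict_keys (\<lambda>m. \<not> ?U m) a" and "b2 = restrict_keys (\<lambda>m. \<not> ?U m) b"
  have split: "a = a1 + a2" "b = b1 + b2"
    unfolding a1_def a2_def b1_def b2_def by (rule restrict_keys_split)+
  have mem: "a1 \<in> ?P" "b1 \<in> ?P" using ab
    by (auto simp: var_prime_eq[OF A] a1_def b1_def keys_restrict_keys)
  have car: "a2 \<in> carrier ?R" using ab by (auto simp: a2_def keys_restrict_keys)
  have "a1 * b \<in> ?P" using ideal.I_r_closed[OF ideal mem(1) ab(2)] by simp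
  moreover have "a2 * b1 \<in> ?P" using ideal.I_l_closed[OF ideal mem(2) car] by simp
  moreover have "a2 * b2 = a * b + - (a1 * b + a2 * b1)" by (simp add: split algebra_simps)
  ultimately have P: "a2 * b2 \<in> ?P" using ab(3)
    by (metis poly_ring_ideal_add[OF ideal] poly_ring_ideal_uminus[OF ideal] poly_ring_sel(2))
  have "Poly_Mapping.keys (a2 * b2) = {}"
  proof (rule ccontr)
    assume "Poly_Mapping.keys (a2 * b2) \<noteq> {}"
    then obtain m where m: "m \<in> Poly_Mapping.keys (a2 * b2)" by blast
    then have "?U m" using P by (auto simp: var_prime_eq[OF A])
    moreover from m have "\<not> ?U m"
      by (rule keys_multE) (auto simp: keys_add_nat a2_def b2_def keys_restrict_keys)
    ultimately show False by blast
  qed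
  then have "a2 = 0 \<or> b2 = 0" by simp
  then show "a \<in> ?P \<or> b \<in> ?P" using mem split by auto
qed

lemma var_prime_subset_iff:
  assumes "A \<subseteq> {1..n}" "B \<subseteq> {1..n}"
  shows "(var_prime n A :: 'k::field mpolynomial set) \<subseteq> var_prime n B \<longleftrightarrow> A \<subseteq> B"
proof
  assume le: "(var_prime n A :: 'k mpolynomial set) \<subseteq> var_prime n B"
  show "A \<subseteq> B"
  proof
    fix i assume "i \<in> A"
    then have "Poly_Mapping.single (Poly_Mapping.single i 1) 1 \<in> (var_prime n A :: 'k mpolynomial set)"
      using assms(1) by (fastforce simp: var_prime_eq)
    with le show "i \<in> B" by (auto simp: var_prime_eq[OF assms(2)])
  qed
qed (use assms in \<open>simp add: var_prime_eq, blast\<close>)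

section \<open>Irredundant intersections of prime ideals\<close>

lemma (in primeideal) pow_mem:
  assumes "a \<in> carrier R" "a [^] (k::nat) \<in> I"
  shows "a \<in> I"
  using assms(2)
proof (induction k)
  case 0
  then have "\<one> \<in> I" by simp
  then show ?case using I_notcarr one_imp_carrier by blast
next
  case (Suc k)
  then show ?case using I_prime[of "a [^] k" a] assms(1) by auto
qed

lemma (in primeideal) radical_of_eq: "radical_of R I = I"
proof
  show "radical_of R I \<subseteq> I" by (auto simp: radical_of_def intro: pow_mem)
  show "I \<subseteq> radical_of R I"
  proof
    fix a assume "a \<in> I"
    then have "a [^] (1::nat) \<in> I" "a \<in> carrier R" using a_Hcarr by auto
    then show "a \<in> radical_of R I" unfolding radical_of_def by blast
  qed
qed

lemma (in primeideal) primary: "primary_ideal R I"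
  unfolding primary_ideal_def radical_of_eq using is_ideal I_notcarr I_prime by blast

text \<open>If no member were inside \<open>P\<close>, the product of elements chosen outside
  \<open>P\<close>, one from each member, would lie in the intersection but not in \<open>P\<close>.
  The empty intersection is the whole ring, which a proper ideal cannot contain.\<close>

lemma family_Inter_subset_primeideal:
  fixes R (structure)
  assumes "primeideal P R" "finite J" "\<And>i. i \<in> J \<Longrightarrow> ideal (Q i) R" "family_Inter R J Q \<subseteq> P"
  shows "\<exists>i\<in>J. Q i \<subseteq> P"
  using assms(2-4)
proof (induction J rule: finite_induct)
  interpret primeideal P R by fact
  case empty
  then show ?case using I_notcarr a_subset by (auto simp: family_Inter_def)
next
  interpret primeideal P R by fact
  case (insert j J)
  show ?case
  proof (rule ccontr)
    assume no: "\<not> (\<exists>i\<in>insert j J. Q i \<subseteq> P)"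
    then obtain a where a: "a \<in> Q j" "a \<notin> P" by auto
    from no insert.IH insert.prems obtain b where b: "b \<in> family_Inter R J Q" "b \<notin> P" by auto
    have ac: "a \<in> carrier R" using a insert.prems(1)[of j] by (auto dest: ideal.Icarr)
    have bc: "b \<in> carrier R" using b by (auto simp: family_Inter_def)
    have "a \<otimes> b \<in> Q j" using a bc insert.prems(1)[of j] by (auto intro: ideal.I_r_closed)
    moreover have "a \<otimes> b \<in> Q i" if "i \<in> J" for i
      using that b ac insert.prems(1)[of i] by (auto simp: family_Inter_def intro: ideal.I_l_closed)
    ultimately have "a \<otimes> b \<in> family_Inter R (insert j J) Q"
      using ac bc by (simp add: family_Inter_def)
    then show False using insert.prems(2) I_prime[OF ac bc] a b by blast
  qed
qed

text \<open>A prime containing a finite intersection contains one of the members. For an antichain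
  of primes this yields irredundancy and identifies the minimal primes; primes are primary and equal
  to their radicals, which settles the rest.\<close>

lemma standard_primary_decompositionI:
  assumes fin: "finite J" and prime: "\<And>i. i \<in> J \<Longrightarrow> primeideal (Q i) R"
    and I: "I = family_Inter R J Q"
    and anti: "\<And>i j. i \<in> J \<Longrightarrow> j \<in> J \<Longrightarrow> Q i \<subseteq> Q j \<Longrightarrow> i = j"
  shows "standard_primary_decomposition R I J Q"
proof -
  have idl: "ideal (Q i) R" if "i \<in> J" for i using prime[OF that] by (rule primeideal.axioms)
  have sub: "I \<subseteq> Q i" if "i \<in> J" for i using that I by (auto simp: family_Inter_def)
  have "I \<noteq> family_Inter R (J - {i}) Q" if i: "i \<in> J" for i
  proof
    assume "I = family_Inter R (J - {i}) Q"
    then have "\<exists>j\<in>J - {i}. Q j \<subseteq> Q i"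
      using family_Inter_subset_primeideal[OF prime[OF i], of "J - {i}" Q] fin idl sub[OF i] by auto
    then show False using anti i by blast
  qed
  moreover have "inj_on (\<lambda>i. radical_of R (Q i)) J"
    by (rule inj_onI) (use anti prime in \<open>simp add: primeideal.radical_of_eq\<close>)
  moreover have "Q ` J = minimal_primes R I"
  proof
    show "Q ` J \<subseteq> minimal_primes R I"
    proof
      fix P assume "P \<in> Q ` J"
      then obtain i where i: "i \<in> J" "P = Q i" by blast
      have "P' = Q i" if P': "primeideal P' R" "I \<subseteq> P'" "P' \<subseteq> Q i" for P'
      proof -
        obtain j where "j \<in> J" "Q j \<subseteq> P'"
          using family_Inter_subset_primeideal[OF P'(1) fin, of Q] idl P'(2) unfolding I by blast
        moreover then have "j = i" using anti i P'(3) by blast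
        ultimately show ?thesis using P'(3) by blast
      qed
      then show "P \<in> minimal_primes R I" using prime sub i by (auto simp: minimal_primes_def)
    qed
    show "minimal_primes R I \<subseteq> Q ` J"
    proof
      fix P assume P: "P \<in> minimal_primes R I"
      then obtain j where "j \<in> J" "Q j \<subseteq> P"
        using family_Inter_subset_primeideal[OF _ fin, of P R Q] idl unfolding minimal_primes_def I by blast
      then show "P \<in> Q ` J" using P prime sub unfolding minimal_primes_def by blast
    qed
  qed
  ultimately show ?thesis
    using fin prime I unfolding standard_primary_decomposition_def minimal_primary_decomposition_def
    by (blast intro: primeideal.primary)
qed

text \<open>Here \<open>S\<close> runs through supports of monomials. \<open>cover\<close> and
  \<open>face\<close> say that \<open>S\<close> contains a generator iff it meets every
  \<open>A i\<close>; with \<open>anti\<close>, the \<open>A i\<close> are the minimal vertex covers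
  of the hypergraph formed by the supports of the generators.\<close>

lemma standard_primary_decomposition_var_prime:
  assumes fin: "finite J" and A: "\<And>i. i \<in> J \<Longrightarrow> A i \<subseteq> {1..n}"
    and L: "\<And>w. w \<in> L \<Longrightarrow> distinct w \<and> set w \<subseteq> {1..n}"
    and cover: "\<And>w i. w \<in> L \<Longrightarrow> i \<in> J \<Longrightarrow> set w \<inter> A i \<noteq> {}"
    and face: "\<And>S. S \<subseteq> {1..n} \<Longrightarrow> (\<And>w. w \<in> L \<Longrightarrow> \<not> set w \<subseteq> S) \<Longrightarrow> \<exists>i\<in>J. S \<inter> A i = {}"
    and anti: "\<And>i j. i \<in> J \<Longrightarrow> j \<in> J \<Longrightarrow> A i \<subseteq> A j \<Longrightarrow> i = j"
  shows "standard_primary_decomposition (poly_ring n) (ideal_of n L :: 'k::field mpolynomial set) J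
    (\<lambda>i. var_prime n (A i))"
proof (rule standard_primary_decompositionI[OF fin])
  show "ideal_of n L = family_Inter (poly_ring n) J (\<lambda>i. var_prime n (A i) :: 'k mpolynomial set)"
  proof (rule Set.set_eqI)
    fix p :: "'k mpolynomial"
    have "(\<exists>w\<in>L. set w \<subseteq> S) \<longleftrightarrow> (\<forall>i\<in>J. S \<inter> A i \<noteq> {})" if "S \<subseteq> {1..n}" for S
      using cover face[OF that] by blast
    then show "p \<in> ideal_of n L \<longleftrightarrow> p \<in> family_Inter (poly_ring n) J (\<lambda>i. var_prime n (A i))"
      using A by (auto simp: ideal_of_eq[OF L] var_prime_eq family_Inter_def)
  qed
qed (use A anti in \<open>auto simp: var_prime_primeideal var_prime_subset_iff\<close>)

text \<open>The squarefree monomial with support \<open>S\<close> lies in both ideals, hence in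
  their intersection. This turns complete lexsegmentness into a statement about sets.\<close>

lemma ideal_of_Int_support:
  assumes L: "\<And>w. w \<in> L1 \<union> L2 \<union> L \<Longrightarrow> distinct w \<and> set w \<subseteq> {1..n}"
    and eq: "(ideal_of n L :: 'k::field mpolynomial set) = ideal_of n L1 \<inter> ideal_of n L2"
    and S: "S \<subseteq> {1..n}" "w1 \<in> L1" "set w1 \<subseteq> S" "w2 \<in> L2" "set w2 \<subseteq> S"
  shows "\<exists>w\<in>L. set w \<subseteq> S"
proof -
  have "finite S" using S(1) by (rule finite_subset) simp
  define m :: "nat \<Rightarrow>\<^sub>0 nat" where "m = (\<Sum>i\<in>S. Poly_Mapping.single i 1)"
  have "Poly_Mapping.lookup m k = (if k \<in> S then 1 else 0)" for k
    using \<open>finite S\<close> by (simp add: m_def lookup_sum lookup_single when_def)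
  then have m: "Poly_Mapping.keys m = S" by (auto simp: in_keys_iff split: if_splits)
  have "Poly_Mapping.single m 1 \<in> (ideal_of n L1 \<inter> ideal_of n L2 :: 'k mpolynomial set)"
    using S m L by (subst (1 2) ideal_of_eq) auto
  then have "Poly_Mapping.single m 1 \<in> (ideal_of n L :: 'k mpolynomial set)" by (simp add: eq)
  then show ?thesis using L m by (subst (asm) ideal_of_eq) auto
qed

section \<open>Spread lists and the squarefree lexicographic order\<close>

text \<open>Sortedness carries the gap from neighbours to arbitrary pairs. The pairwise form is the
  one suited to induction on lists and to splitting them.\<close>

lemma t_spread_iff: "t_spread t w \<longleftrightarrow> sorted_wrt (\<lambda>x y. x + t \<le> y) w"
proof
  assume w: "t_spread t w"
  have "w ! i + t \<le> w ! j" if "i < j" "j < length w" for i j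
  proof -
    have "w ! i + t \<le> w ! Suc i" using w that by (simp add: t_spread_def)
    also have "\<dots> \<le> w ! j" using w that by (simp add: t_spread_def sorted_nth_mono)
    finally show ?thesis .
  qed
  then show "sorted_wrt (\<lambda>x y. x + t \<le> y) w" by (simp add: sorted_wrt_iff_nth_less)
next
  assume w: "sorted_wrt (\<lambda>x y. x + t \<le> y) w"
  then have "sorted w" by (rule sorted_wrt_mono_rel[rotated]) simp
  with w show "t_spread t w" by (auto simp: t_spread_def intro: sorted_wrt_nth_less)
qed

lemma t_spread_simps [simp]:
  "t_spread t []" "t_spread t (x # w) \<longleftrightarrow> (\<forall>y\<in>set w. x + t \<le> y) \<and> t_spread t w"
  by (simp_all add: t_spread_iff)

lemma t_spread_distinct:
  assumes "t_spread t w" "t \<ge> 1"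
  shows "distinct w"
  using assms by (induction w) force+

lemma t_spread_length_bound:
  assumes "t_spread t x" "set x \<subseteq> {b..n}" "length x = Suc k"
  shows "b + k * t \<le> n"
  using assms
proof (induction k arbitrary: x b)
  case 0
  then show ?case by (cases x) auto
next
  case (Suc k)
  then obtain y x' where x: "x = y # x'" by (cases x) auto
  have "set x' \<subseteq> {b + t..n}" using Suc.prems x by fastforce
  then have "b + t + k * t \<le> n" using Suc x by auto
  then show ?case by simp
qed

lemma slex_gt_simps [simp]:
  "\<not> [] >slex w" "\<not> v >slex []"
  "x # v >slex y # w \<longleftrightarrow> length v = length w \<and> (x < y \<or> x = y \<and> v >slex w)"
proof -
  show "x # v >slex y # w \<longleftrightarrow> length v = length w \<and> (x < y \<or> x = y \<and> v >slex w)"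
    unfolding slex_gt_def by (auto simp: Ex_less_Suc2 All_less_Suc2)
qed (auto simp: slex_gt_def)

lemma slex_ge_simps [simp]:
  "[] \<ge>slex []"
  "x # v \<ge>slex y # w \<longleftrightarrow> length v = length w \<and> (x < y \<or> x = y \<and> v \<ge>slex w)"
  by (auto simp: slex_ge_def)

lemma slex_gt_length: "v >slex w \<Longrightarrow> length v = length w"
  by (simp add: slex_gt_def)

lemma slex_ge_length: "v \<ge>slex w \<Longrightarrow> length v = length w"
  by (auto simp: slex_ge_def slex_gt_def)

lemma slex_gt_iff_not_ge: "length v = length w \<Longrightarrow> v >slex w \<longleftrightarrow> \<not> w \<ge>slex v"
  by (induction v w rule: list_induct2) auto

lemma slex_ge_gt_trans: "a \<ge>slex b \<Longrightarrow> b >slex c \<Longrightarrow> a >slex c"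
proof (induction a arbitrary: b c)
  case Nil
  then show ?case by (auto simp: slex_ge_def)
next
  case (Cons x a)
  then obtain y b' z c' where "b = y # b'" "c = z # c'"
    by (metis slex_ge_length slex_gt_length length_Suc_conv)
  then show ?case using Cons by auto
qed

section \<open>Unions of blocks\<close>

lemma supp_t_simps [simp]:
  "supp_t t [] = {}" "supp_t t (l # w) = {l..l + (t - 1)} \<union> supp_t t w"
  by (simp_all add: supp_t_def)

lemma cosupp_t_simps [simp]:
  "cosupp_t t [] = {}" "cosupp_t t (l # w) = {l - (t - 1)..l} \<union> cosupp_t t w"
  by (simp_all add: cosupp_t_def)

lemma set_subset_supp_t: "set w \<subseteq> supp_t t w"
  by (auto simp: supp_t_def)

lemma set_subset_cosupp_t: "set w \<subseteq> cosupp_t t w"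
  by (auto simp: cosupp_t_def)

lemma cosupp_t_append: "cosupp_t t (a @ b) = cosupp_t t a \<union> cosupp_t t b"
  by (auto simp: cosupp_t_def)

lemma finite_supp_t [simp]: "finite (supp_t t w)"
  by (simp add: supp_t_def)

lemma finite_cosupp_t [simp]: "finite (cosupp_t t w)"
  by (simp add: cosupp_t_def)

text \<open>A block reaching right from \<open>l\<close> is the block reaching left from
  \<open>l + (t - 1)\<close>. This is how blocks attached to \<open>v\<close> are compared with
  members of \<open>G_family\<close>.\<close>

lemma cosupp_t_shift: "cosupp_t t (shift t w) = supp_t t w"
  by (simp add: cosupp_t_def supp_t_def shift_def)

lemma t_spread_shift: "t_spread t w \<Longrightarrow> t_spread t (shift t w)"
  by (induction w) (auto simp: shift_def)

lemma length_shift [simp]: "length (shift t w) = length w"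
  by (simp add: shift_def)

text \<open>Spreadness makes the blocks disjoint, and \<open>t \<le> l\<close> keeps the truncated
  subtraction from shortening one.\<close>

lemma card_cosupp_t:
  assumes "t_spread t w" "t \<ge> 1" "\<forall>l\<in>set w. t \<le> l"
  shows "card (cosupp_t t w) = length w * t"
  using assms
proof (induction w)
  case (Cons l w)
  have "{l - (t - 1)..l} \<inter> cosupp_t t w = {}"
    using Cons.prems by (fastforce simp: cosupp_t_def)
  then have "card (cosupp_t t (l # w)) = card {l - (t - 1)..l} + card (cosupp_t t w)"
    by (simp add: card_Un_disjoint)
  also have "card {l - (t - 1)..l} = t" using Cons.prems by simp
  finally show ?case using Cons by simp
qed simp

lemma card_supp_t:
  assumes "t_spread t w" "t \<ge> 1" "\<forall>l\<in>set w. 1 \<le> l"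
  shows "card (supp_t t w) = length w * t"
proof -
  have "\<forall>l\<in>set (shift t w). t \<le> l" using assms by (auto simp: shift_def)
  then show ?thesis
    using card_cosupp_t[OF t_spread_shift[OF assms(1)] assms(2)] by (simp add: cosupp_t_shift)
qed

text \<open>Pigeonhole: a block of \<open>t\<close> consecutive numbers holds at most one entry of a
  spread list.\<close>

lemma length_le_if_subset_supp_t:
  assumes "t_spread t x" "t_spread t w" "t \<ge> 1" "set x \<subseteq> supp_t t w"
  shows "length x \<le> length w"
  using assms
proof (induction w arbitrary: x)
  case (Cons l w)
  show ?case
  proof (cases x)
    case x: (Cons y x')
    have "l \<le> y" using Cons.prems x by (fastforce simp: supp_t_def)
    then have "set x' \<subseteq> supp_t t w" using Cons.prems x by fastforce
    then show ?thesis using Cons x by auto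
  qed simp
qed simp

text \<open>The head \<open>y\<close> is at least the left end of the first block, so everything
  from \<open>y + t\<close> on lies beyond that block.\<close>

lemma subset_cosupp_t_Cons:
  assumes "t_spread t (y # x)" "t_spread t (l # w)" "t \<ge> 1" "set (y # x) \<subseteq> cosupp_t t (l # w)"
  shows "set x \<subseteq> cosupp_t t w"
proof -
  have "l < z" if "z \<in> cosupp_t t w" for z
    using that assms(2,3) by (fastforce simp: cosupp_t_def)
  then have "l < y + t" using assms(3,4) by fastforce
  then show ?thesis using assms(1,4) by fastforce
qed

lemma length_le_if_subset_cosupp_t:
  assumes "t_spread t x" "t_spread t w" "t \<ge> 1" "set x \<subseteq> cosupp_t t w"
  shows "length x \<le> length w"
  using assms
proof (induction w arbitrary: x)
  case (Cons l w)
  show ?case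
  proof (cases x)
    case (Cons y x')
    then show ?thesis using Cons.IH[of x'] Cons.prems subset_cosupp_t_Cons[of t y x' l w] by auto
  qed simp
qed simp

text \<open>With as many entries as blocks, the pigeonhole principle forces the head of
  \<open>x\<close> into the first block, whose right end is the head of \<open>w\<close>; then
  recurse.\<close>

lemma slex_ge_if_subset_cosupp_t:
  assumes "t_spread t x" "t_spread t w" "t \<ge> 1" "set x \<subseteq> cosupp_t t w" "length x = length w"
  shows "x \<ge>slex w"
  using assms
proof (induction w arbitrary: x)
  case (Cons l w)
  then obtain y x' where x: "x = y # x'" by (cases x) auto
  have x': "set x' \<subseteq> cosupp_t t w" using subset_cosupp_t_Cons[of t y x' l w] Cons.prems x by auto
  have "y \<le> l"
  proof (rule ccontr)
    assume "\<not> y \<le> l"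
    then have "set x \<subseteq> cosupp_t t w" using x x' Cons.prems by auto
    then show False using length_le_if_subset_cosupp_t[of t x w] Cons.prems by auto
  qed
  then show ?case using Cons.IH[of x'] Cons.prems x x' by auto
qed simp

text \<open>Since \<open>1 # w\<close> is spread, all blocks of \<open>w\<close> lie above 1, and 1
  acts as an additional block of length one in front of them.\<close>

lemma slex_ge_if_subset_insert_cosupp_t:
  assumes "t_spread t x" "t_spread t (1 # w)" "t \<ge> 1" "set x \<subseteq> cosupp_t t w \<union> {1}"
    "length x = Suc (length w)"
  shows "x \<ge>slex 1 # w"
proof -
  obtain y x' where x: "x = y # x'" using assms(5) by (cases x) auto
  have ge: "z > 1" if "z \<in> cosupp_t t w" for z
    using that assms(2,3) by (fastforce simp: cosupp_t_def)
  have y1: "y \<ge> 1" using ge[of y] assms(4) x by auto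
  then have "set x' \<subseteq> cosupp_t t w" using assms(1,3,4) x by fastforce
  then have "x' \<ge>slex w" using slex_ge_if_subset_cosupp_t assms x by auto
  moreover have "y = 1"
  proof (rule ccontr)
    assume "y \<noteq> 1"
    then have "set x \<subseteq> cosupp_t t w" using \<open>set x' \<subseteq> _\<close> x assms(4) by auto
    then show False using length_le_if_subset_cosupp_t[of t x w] assms by auto
  qed
  ultimately show ?thesis using x slex_ge_length by auto
qed

section \<open>Covering a set without long spread lists\<close>

text \<open>Greedy choice from the left: the first block starts at the least element of
  \<open>S\<close>, and the part of \<open>S\<close> beyond that block contains no spread list with
  \<open>k\<close> entries when the induction step asks for \<open>k\<close> blocks in all. The
  bound on \<open>l\<close> keeps the blocks inside \<open>{a..n}\<close>.\<close>

lemma supp_t_cover: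
  assumes "t \<ge> 1" "a + k * t \<le> n + 1" "S \<subseteq> {a..n}"
    "\<And>x. t_spread t x \<Longrightarrow> length x = Suc k \<Longrightarrow> \<not> set x \<subseteq> S"
  shows "\<exists>w. t_spread t w \<and> length w = k \<and> (\<forall>l\<in>set w. a \<le> l \<and> l + t \<le> n + 1) \<and> S \<subseteq> supp_t t w"
  using assms(2-4)
proof (induction k arbitrary: a S)
  case 0
  have "S = {}" using "0.prems"(3)[of "[_]"] by auto
  then show ?case by auto
next
  case (Suc k)
  have fin: "finite S" using Suc.prems(2) by (rule finite_subset) simp
  \<comment> \<open>The block would start at \<open>Min S\<close>, but is moved left if fewer than
    \<open>Suc k * t\<close> numbers remain from there up to \<open>n\<close>; for empty
    \<open>S\<close> the last admissible start is taken.\<close>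
  define m where "m = (if S = {} then n + 1 - Suc k * t else min (Min S) (n + 1 - Suc k * t))"
  have le: "m \<le> s" if "s \<in> S" for s
    using that Min_le[OF fin that] by (auto simp: m_def simp del: mult_Suc)
  have am: "a \<le> m" using Suc.prems(1,2) fin by (auto simp: m_def)
  have room: "m + Suc k * t \<le> n + 1" using Suc.prems(1) by (auto simp: m_def)
  have "\<not> set x \<subseteq> S \<inter> {m + t..n}" if x: "t_spread t x" "length x = Suc k" for x
  proof
    assume sub: "set x \<subseteq> S \<inter> {m + t..n}"
    show False
    proof (cases "m \<in> S")
      case True
      then have "t_spread t (m # x)" "set (m # x) \<subseteq> S" "length (m # x) = Suc (Suc k)"
        using x sub by auto
      then show False using Suc.prems(3) by blast
    next
      case False
      have "S \<noteq> {}" using sub x by (cases x) auto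
      \<comment> \<open>The start was moved, so exactly \<open>Suc k * t\<close> numbers remain from
        \<open>m\<close> on. A spread list with \<open>Suc k\<close> entries beginning at
        \<open>m + t\<close> or later does not fit.\<close>
      then have "m = n + 1 - Suc k * t" using False Min_in[OF fin] by (auto simp: m_def min_def simp del: mult_Suc split: if_splits)
      then have "m + Suc k * t = n + 1" using Suc.prems(1) by auto
      moreover have "m + t + k * t \<le> n"
        using t_spread_length_bound[of t x "m + t" n k] x sub by auto
      ultimately show False by simp
    qed
  qed
  then obtain w where w: "t_spread t w" "length w = k" "\<forall>l\<in>set w. m + t \<le> l \<and> l + t \<le> n + 1"
    "S \<inter> {m + t..n} \<subseteq> supp_t t w"
    using Suc.IH[of "m + t" "S \<inter> {m + t..n}"] room by (auto simp: add_ac)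
  have "S \<subseteq> supp_t t (m # w)"
  proof
    fix s assume s: "s \<in> S"
    show "s \<in> supp_t t (m # w)"
    proof (cases "s < m + t")
      case True
      then show ?thesis using le[OF s] by auto
    next
      case False
      then have "s \<in> S \<inter> {m + t..n}" using s Suc.prems(2) by auto
      then show ?thesis using w(4) by auto
    qed
  qed
  then show ?case using w am room by (intro exI[of _ "m # w"]) force
qed

text \<open>Compare the least element \<open>m\<close> of \<open>S\<close> with the head
  \<open>j\<close> of the list. If \<open>m > j\<close>, then \<open>S\<close> lies above
  \<open>j\<close>. If \<open>m < j\<close>, no spread list of full length fits into
  \<open>S\<close> and \<open>supp_t_cover\<close> applies. If \<open>m = j\<close>, the first block
  starts at \<open>j\<close> and the argument continues beyond it.\<close>

lemma initial_face_cover: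
  assumes "t \<ge> 1" "v \<noteq> []" "t_spread t v" "set v \<subseteq> {a..n}" "S \<subseteq> {a..n}"
    "\<And>x. t_spread t x \<Longrightarrow> set x \<subseteq> S \<Longrightarrow> \<not> x \<ge>slex v"
  shows "(\<exists>p<length v. S \<subseteq> supp_t t (take p v) \<union> {v ! p<..n}) \<or>
    (\<exists>w. t_spread t w \<and> (\<forall>l\<in>set w. a \<le> l \<and> l + t \<le> n + 1) \<and> S \<subseteq> supp_t t w \<and> w >slex butlast v)"
  using assms(2-6)
proof (induction v arbitrary: a S)
  case (Cons j v)
  have fin: "finite S" using Cons.prems(4) by (rule finite_subset) simp
  show ?case
  proof (cases "\<exists>s\<in>S. s \<le> j")
    case False
    then have "S \<subseteq> supp_t t (take 0 (j # v)) \<union> {(j # v) ! 0<..n}"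
      using Cons.prems(4) by (auto simp: subset_iff not_le)
    then show ?thesis by blast
  next
    case True
    define m where "m = Min S"
    have m: "m \<in> S" "\<And>s. s \<in> S \<Longrightarrow> m \<le> s"
      using True Min_in[OF fin] Min_le[OF fin] unfolding m_def by auto
    have mlej: "m \<le> j" using True m(2) by force
    have "v \<noteq> []"
    proof
      assume "v = []"
      then have "t_spread t [m]" "set [m] \<subseteq> S" "[m] \<ge>slex j # v" using m mlej by auto
      then show False using Cons.prems(5) by blast
    qed
    then obtain k where k: "length v = Suc k" by (cases v) auto
    have "set v \<subseteq> {j + t..n}" using Cons.prems(2,3) by (auto simp: subset_iff)
    then have room: "j + t + k * t \<le> n"
      using t_spread_length_bound[of t v "j + t" n k] Cons.prems(2) k by simp
    show ?thesis
    proof (cases "m < j")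
      case True
      have "\<not> set x \<subseteq> S" if x: "t_spread t x" "length x = Suc (length v)" for x
      proof
        assume S: "set x \<subseteq> S"
        obtain y x' where xy: "x = y # x'" using x by (cases x) auto
        \<comment> \<open>Replacing the head of a spread list in \<open>S\<close> by the minimum
          keeps it spread and puts it before \<open>j # v\<close>.\<close>
        have "t_spread t (m # x')" "set (m # x') \<subseteq> S" "m # x' \<ge>slex j # v"
          using m(2)[of y] S x xy True m(1) by auto
        then show False using Cons.prems(5) by blast
      qed
      moreover have "S \<subseteq> {m..n}" using m(2) Cons.prems(4) by auto
      moreover have "m + length v * t \<le> n + 1" using room k True by auto
      ultimately obtain w where w: "t_spread t w" "length w = length v"
          "\<forall>l\<in>set w. m \<le> l \<and> l + t \<le> n + 1" "S \<subseteq> supp_t t w"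
        using supp_t_cover[OF assms(1), of m "length v" n S] by blast
      obtain l w' where lw: "w = l # w'" using w k by (cases w) auto
      \<comment> \<open>Some block must contain \<open>m\<close>, so the first block starts no later
        than \<open>m\<close>; since \<open>m < j\<close>, the head alone decides the comparison
        with \<open>butlast (j # v)\<close>.\<close>
      have "l \<le> m" using m(1) w lw by (fastforce simp: supp_t_def)
      then have "w >slex butlast (j # v)" using lw \<open>v \<noteq> []\<close> w True by auto
      moreover have "a \<le> m" using m Cons.prems(4) by auto
      ultimately show ?thesis using w by (intro disjI2 exI[of _ w]) auto
    next
      case False
      then have mj: "m = j" using mlej by simp
      let ?S = "S \<inter> {j + t..n}"
      have "\<not> x \<ge>slex v" if x: "t_spread t x" "set x \<subseteq> ?S" for x
      proof
        assume "x \<ge>slex v"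
        then have "t_spread t (j # x)" "set (j # x) \<subseteq> S" "j # x \<ge>slex j # v"
          using x m mj by (auto dest: slex_ge_length)
        then show False using Cons.prems(5) by blast
      qed
      moreover have "set v \<subseteq> {j + t..n}" using Cons.prems by fastforce
      ultimately have "(\<exists>p<length v. ?S \<subseteq> supp_t t (take p v) \<union> {v ! p<..n}) \<or>
        (\<exists>w. t_spread t w \<and> (\<forall>l\<in>set w. j + t \<le> l \<and> l + t \<le> n + 1) \<and> ?S \<subseteq> supp_t t w \<and> w >slex butlast v)"
        using Cons.IH[of "j + t" ?S] Cons.prems \<open>v \<noteq> []\<close> by auto
      moreover have S: "S \<subseteq> {j..j + (t - 1)} \<union> ?S"
      proof
        fix s assume "s \<in> S"
        then show "s \<in> {j..j + (t - 1)} \<union> ?S" using m(2)[of s] mj Cons.prems(4) assms(1) by auto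
      qed
      ultimately show ?thesis
      proof (elim disjE exE conjE)
        fix p assume "p < length v" "?S \<subseteq> supp_t t (take p v) \<union> {v ! p<..n}"
        then have "S \<subseteq> supp_t t (take (Suc p) (j # v)) \<union> {(j # v) ! Suc p<..n}" "Suc p < length (j # v)"
          using S by auto
        then show ?thesis by blast
      next
        fix w assume w: "t_spread t w" "\<forall>l\<in>set w. j + t \<le> l \<and> l + t \<le> n + 1" "?S \<subseteq> supp_t t w"
          "w >slex butlast v"
        have "a \<le> j" "j + t \<le> n + 1" using room Cons.prems(3) by auto
        then have "t_spread t (j # w)" "\<forall>l\<in>set (j # w). a \<le> l \<and> l + t \<le> n + 1"
          "S \<subseteq> supp_t t (j # w)" "j # w >slex butlast (j # v)"
          using w S \<open>v \<noteq> []\<close> slex_gt_length[OF w(4)] by auto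
        then show ?thesis by blast
      qed
    qed
  qed
qed simp

text \<open>Greedy choice from the right. The last clause, maximality of the head \<open>x\<close>,
  carries the induction: an element of \<open>S\<close> heads a spread list with one more entry
  exactly when it lies at least \<open>t\<close> below \<open>x\<close>.\<close>

lemma cosupp_t_cover:
  assumes "t \<ge> 1" "finite S" "t_spread t y" "length y = Suc k" "set y \<subseteq> S"
  shows "\<exists>x w. t_spread t (x # w) \<and> length w = k \<and> set (x # w) \<subseteq> S \<and> S \<subseteq> {..x} \<union> cosupp_t t w \<and>
    (\<forall>z z'. t_spread t (z # z') \<longrightarrow> length z' = k \<longrightarrow> set (z # z') \<subseteq> S \<longrightarrow> z \<le> x)"
  using assms(3-5)
proof (induction k arbitrary: y)
  case 0
  then have "S \<noteq> {}" by (cases y) auto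
  then show ?case using assms(2) by (intro exI[of _ "Max S"] exI[of _ "[]"]) auto
next
  case (Suc k)
  obtain y1 y2 y' where y: "y = y1 # y2 # y'" "length y' = k"
    using Suc.prems(2) by (auto simp: length_Suc_conv)
  obtain x w where xw: "t_spread t (x # w)" "length w = k" "set (x # w) \<subseteq> S"
      "S \<subseteq> {..x} \<union> cosupp_t t w"
      "\<forall>z z'. t_spread t (z # z') \<longrightarrow> length z' = k \<longrightarrow> set (z # z') \<subseteq> S \<longrightarrow> z \<le> x"
    using Suc.IH[of "y2 # y'"] Suc.prems y by auto
  let ?T = "{s \<in> S. s + t \<le> x}"
  have hd: "z \<in> ?T" if "t_spread t (z # z')" "length z' = Suc k" "set (z # z') \<subseteq> S" for z z'
  proof -
    obtain b z'' where z': "z' = b # z''" using \<open>length z' = Suc k\<close> by (auto simp: length_Suc_conv)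
    then have "b \<le> x" using xw(5) that by auto
    then show ?thesis using that z' by auto
  qed
  have T: "finite ?T" "?T \<noteq> {}" using assms(2) hd[of y1 "y2 # y'"] Suc.prems y by auto
  define m where "m = Max ?T"
  have m: "m \<in> S" "m + t \<le> x" "\<And>s. s \<in> ?T \<Longrightarrow> s \<le> m"
    using Max_in[OF T] Max_ge[OF T(1)] unfolding m_def by auto
  \<comment> \<open>By the choice of \<open>m\<close>, elements of \<open>S\<close> in
    \<open>{m<..x}\<close> are less than \<open>t\<close> below \<open>x\<close>, hence in the block
    ending at \<open>x\<close>.\<close>
  have "S \<subseteq> {..m} \<union> cosupp_t t (x # w)"
  proof
    fix s assume s: "s \<in> S"
    then have "s \<le> x \<or> s \<in> cosupp_t t w" using xw(4) by auto
    moreover have "s \<le> m" if "s + t \<le> x" using m(3) s that by auto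
    ultimately show "s \<in> {..m} \<union> cosupp_t t (x # w)" by fastforce
  qed
  moreover have "t_spread t (m # x # w)" using xw(1) m(2) by fastforce
  ultimately show ?case using xw m hd
    by (intro exI[of _ m] exI[of _ "x # w"]) (auto simp del: t_spread_simps(2))
qed

section \<open>The sets attached to \<open>v\<close>\<close>

text \<open>While \<open>x\<close> agrees with \<open>v\<close>, its next entry cannot be smaller
  than that of \<open>v\<close>, and at position \<open>p\<close> it must be strictly larger. So
  these sets contain no list of the initial segment of \<open>v\<close>.\<close>

lemma slex_gt_if_subset_prefix_set:
  assumes "t \<ge> 1" "t_spread t v" "p < length v" "t_spread t x" "length x = length v"
    "set x \<subseteq> supp_t t (take p v) \<union> {v ! p<..n}"
  shows "v >slex x"
  using assms(2-6)
proof (induction v arbitrary: p x)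
  case (Cons j v)
  then obtain y x' where x: "x = y # x'" by (cases x) auto
  show ?case
  proof (cases p)
    case 0
    then show ?thesis using Cons.prems x by auto
  next
    case (Suc q)
    have vq: "j + t \<le> v ! q" using Cons.prems Suc by auto
    have ge: "z \<ge> j + t" if "z \<in> supp_t t (take q v)" for z
      using that Cons.prems(1) by (fastforce simp: supp_t_def dest: in_set_takeD)
    have "y \<ge> j" using Cons.prems(5) x Suc vq ge[of y] by auto
    moreover have "v >slex x'" if "y = j"
    proof -
      have "set x' \<subseteq> supp_t t (take q v) \<union> {v ! q<..n}"
        using Cons.prems(3,5) x Suc that assms(1) by fastforce
      then show ?thesis using Cons.IH[of q x'] Cons.prems x Suc by auto
    qed
    ultimately show ?thesis using x Cons.prems by auto
  qed
qed simp

text \<open>The same comparison one entry shorter. It keeps unions of blocks coming from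
  \<open>F_tilde\<close> from lying inside the complement of some \<open>F_set\<close>.\<close>

lemma not_slex_gt_if_subset_prefix_set:
  assumes "t \<ge> 1" "t_spread t v" "p < length v" "t_spread t w"
    "set w \<subseteq> supp_t t (take p v) \<union> {v ! p<..n}"
  shows "\<not> w >slex butlast v"
  using assms(2-5)
proof (induction v arbitrary: p w)
  case (Cons j v)
  show ?case
  proof
    assume gt: "w >slex butlast (j # v)"
    then obtain l w' where w: "w = l # w'" by (cases w) auto
    have v: "v \<noteq> []" using gt by auto
    show False
    proof (cases p)
      case 0
      then show False using Cons.prems gt w v by auto
    next
      case (Suc q)
      have vq: "j + t \<le> v ! q" using Cons.prems Suc by auto
      have ge: "z \<ge> j + t" if "z \<in> supp_t t (take q v)" for z
        using that Cons.prems(1) by (fastforce simp: supp_t_def dest: in_set_takeD)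
      have "l \<ge> j" using Cons.prems(4) w Suc vq ge[of l] by auto
      then have l: "l = j" "w' >slex butlast v" using gt w v by auto
      then have "set w' \<subseteq> supp_t t (take q v) \<union> {v ! q<..n}"
        using Cons.prems(3,4) w Suc assms(1) by fastforce
      then show False using Cons.IH[of q w'] Cons.prems w Suc l by auto
    qed
  qed
qed simp

lemma t_spread_nth:
  assumes "t_spread t v" "p < length v"
  shows "x \<in> set (take p v) \<Longrightarrow> x + t \<le> v ! p" "y \<in> set (drop (Suc p) v) \<Longrightarrow> v ! p + t \<le> y"
proof -
  have "sorted_wrt (\<lambda>x y. x + t \<le> y) (take p v @ v ! p # drop (Suc p) v)"
    using assms by (simp add: t_spread_iff flip: id_take_nth_drop)
  then show "x \<in> set (take p v) \<Longrightarrow> x + t \<le> v ! p" "y \<in> set (drop (Suc p) v) \<Longrightarrow> v ! p + t \<le> y"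
    by (auto simp: sorted_wrt_append)
qed

text \<open>The lower bound holds because the entries of \<open>v\<close> after position
  \<open>p\<close> form a spread list above \<open>v ! p\<close>, which takes up at least
  \<open>(length v - Suc p) * t\<close> numbers.\<close>

lemma card_prefix_set:
  assumes "t \<ge> 1" "t_spread t v" "set v \<subseteq> {1..n}" "p < length v"
  shows "card (supp_t t (take p v) \<union> {v ! p<..n}) = p * t + (n - v ! p)"
    and "(length v - 1) * t \<le> p * t + (n - v ! p)"
proof -
  have split: "v = take p v @ v ! p # drop (Suc p) v" using assms(4) by (rule id_take_nth_drop)
  have sw: "sorted_wrt (\<lambda>x y. x + t \<le> y) (take p v @ v ! p # drop (Suc p) v)"
    using assms(2) split by (simp add: t_spread_iff)
  have "supp_t t (take p v) \<inter> {v ! p<..n} = {}"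
    using sw by (fastforce simp: supp_t_def sorted_wrt_append)
  then have "card (supp_t t (take p v) \<union> {v ! p<..n}) = card (supp_t t (take p v)) + card {v ! p<..n}"
    by (simp add: card_Un_disjoint)
  moreover have "card (supp_t t (take p v)) = length (take p v) * t"
    using sw assms by (intro card_supp_t)
      (auto simp: t_spread_iff sorted_wrt_append dest!: in_set_takeD)
  ultimately show "card (supp_t t (take p v) \<union> {v ! p<..n}) = p * t + (n - v ! p)"
    using assms(4) by simp
  have "t_spread t (v ! p # drop (Suc p) v)" using sw unfolding t_spread_iff sorted_wrt_append by blast
  moreover have "set (v ! p # drop (Suc p) v) \<subseteq> {v ! p..n}"
    using t_spread_nth(2)[OF assms(2,4)] nth_mem[OF assms(4)] assms(3)
    by (force dest: in_set_dropD)
  ultimately have "v ! p + (length v - Suc p) * t \<le> n"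
    by (rule t_spread_length_bound) simp
  moreover have "(length v - 1) * t = p * t + (length v - Suc p) * t"
    using assms(4) by (simp flip: add_mult_distrib)
  ultimately show "(length v - 1) * t \<le> p * t + (n - v ! p)" by simp
qed

text \<open>The left blocks of the shifted entries are the right blocks of the original ones, and
  those of the later entries stay above \<open>v ! p\<close>. The lower bound on the entries makes
  \<open>1 # c\<close> spread once \<open>v ! 0\<close> is at least 2, so that \<open>c\<close> can
  produce a member of \<open>G_family\<close>.\<close>

lemma shifted_prefix:
  assumes "t \<ge> 1" "t_spread t v" "set v \<subseteq> {1..n}" "p < length v"
  defines "c \<equiv> shift t (take p v) @ drop (Suc p) v"
  shows "t_spread t c" "\<forall>l\<in>set c. v ! 0 + t \<le> Suc l \<and> l \<le> n" "length c = length v - 1"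
    "cosupp_t t c \<subseteq> supp_t t (take p v) \<union> {v ! p<..n}" "2 \<le> v ! 0 \<Longrightarrow> t_spread t (1 # c)"
proof -
  have split: "v = take p v @ v ! p # drop (Suc p) v" using assms(4) by (rule id_take_nth_drop)
  have sw: "sorted_wrt (\<lambda>x y. x + t \<le> y) (take p v @ v ! p # drop (Suc p) v)"
    using assms(2) split by (simp add: t_spread_iff)
  note pre = t_spread_nth(1)[OF assms(2,4)] and suf = t_spread_nth(2)[OF assms(2,4)]
  have "t_spread t (shift t (take p v))"
    using sw by (intro t_spread_shift) (auto simp: t_spread_iff sorted_wrt_append)
  moreover have "t_spread t (drop (Suc p) v)"
    using sw by (auto simp: t_spread_iff sorted_wrt_append)
  \<comment> \<open>Dropping \<open>v ! p\<close> makes room for the shift: shifted entries stay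
    below \<open>v ! p\<close>, later ones start at \<open>v ! p + t\<close>.\<close>
  moreover have "z + t \<le> y" if "z \<in> set (shift t (take p v))" "y \<in> set (drop (Suc p) v)" for y z
    using that pre suf assms(1) by (fastforce simp: shift_def)
  ultimately show sp: "t_spread t c" by (auto simp: c_def t_spread_iff sorted_wrt_append)
  have v0: "v ! 0 \<le> x" if "x \<in> set v" for x
    using that assms(2) by (cases v) auto
  have vp: "v ! p \<in> set v" "v ! p \<le> n" using assms(3) nth_mem[OF assms(4)] by auto
  show mem: "\<forall>l\<in>set c. v ! 0 + t \<le> Suc l \<and> l \<le> n"
  proof
    fix l assume "l \<in> set c"
    then consider x where "x \<in> set (take p v)" "l = x + (t - 1)" | "l \<in> set (drop (Suc p) v)"
      by (auto simp: c_def shift_def)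
    then show "v ! 0 + t \<le> Suc l \<and> l \<le> n"
    proof cases
      case 1
      then show ?thesis using pre[of x] v0[of x] vp assms(1) by (auto dest: in_set_takeD)
    next
      case 2
      then have "l \<in> set v" by (rule in_set_dropD)
      then show ?thesis using suf[OF 2] v0[OF vp(1)] assms(3) by auto
    qed
  qed
  show "length c = length v - 1" using assms(4) by (simp add: c_def)
  have "cosupp_t t (drop (Suc p) v) \<subseteq> {v ! p<..n}"
  proof
    fix z assume "z \<in> cosupp_t t (drop (Suc p) v)"
    then obtain l where l: "l \<in> set (drop (Suc p) v)" "l - (t - 1) \<le> z" "z \<le> l"
      by (auto simp: cosupp_t_def)
    then have "l \<in> set v" by (blast dest: in_set_dropD)
    then show "z \<in> {v ! p<..n}" using l suf[OF l(1)] assms(1,3) by auto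
  qed
  then show "cosupp_t t c \<subseteq> supp_t t (take p v) \<union> {v ! p<..n}"
    by (auto simp: c_def cosupp_t_append cosupp_t_shift)
  show "t_spread t (1 # c)" if "2 \<le> v ! 0" using sp mem that by fastforce
qed

lemma F_set_complement:
  assumes "t \<ge> 1" "t_spread t v" "set v \<subseteq> {1..n}" "p < length v"
  shows "{1..n} - F_set t v (Suc p) = supp_t t (take p v) \<union> {v ! p<..n}"
    and "F_set t v (Suc p) \<subseteq> {1..n}"
proof -
  note t_spread_nth(1)[OF assms(2,4)]
  moreover have "v ! p \<in> {1..n}" using assms(3,4) nth_mem by blast
  moreover have "1 \<le> x" if "x \<in> set (take p v)" for x
    using assms(3) that by (auto dest: in_set_takeD)
  ultimately have "supp_t t (take p v) \<subseteq> {1..v ! p - 1}" "v ! p \<in> {1..n}"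
    using assms(1) by (fastforce simp: supp_t_def)+
  then show "{1..n} - F_set t v (Suc p) = supp_t t (take p v) \<union> {v ! p<..n}"
    "F_set t v (Suc p) \<subseteq> {1..n}"
    by (auto simp: F_set_def subset_iff)
qed

text \<open>The number \<open>v ! q\<close> is missing from the set at position \<open>q\<close> but
  belongs to the one at every other position: earlier positions admit everything larger, later ones
  contain its block.\<close>

lemma prefix_set_antichain:
  assumes "t \<ge> 1" "t_spread t v" "set v \<subseteq> {1..n}" "p < length v" "q < length v"
    "supp_t t (take p v) \<union> {v ! p<..n} \<subseteq> supp_t t (take q v) \<union> {v ! q<..n}"
  shows "p = q"
proof -
  have notin: "v ! p \<notin> supp_t t (take p v) \<union> {v ! p<..n}" if "p < length v" for p
    using t_spread_nth(1)[OF assms(2) that] assms(1) by (fastforce simp: supp_t_def)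
  have less: "v ! i < v ! j" if "i < j" "j < length v" for i j
    using sorted_wrt_nth_less[of "\<lambda>x y. x + t \<le> y" v i j] assms(1,2) that by (simp add: t_spread_iff)
  have le: "v ! i \<le> n" if "i < length v" for i using assms(3) nth_mem[OF that] by auto
  show ?thesis
  proof (rule linorder_cases[of p q])
    assume pq: "p < q"
    then have "v ! q \<in> {v ! p<..n}" using less le assms(5) by auto
    then show ?thesis using notin[OF assms(5)] assms(6) by auto
  next
    assume qp: "q < p"
    then have "v ! q \<in> set (take p v)" using assms(4) by (auto simp: in_set_conv_nth)
    then have "v ! q \<in> supp_t t (take p v)" using set_subset_supp_t by blast
    then show ?thesis using notin[OF assms(5)] assms(6) by auto
  qed
qed

lemma remove1_Max_t_spread:
  assumes "t_spread t v" "t \<ge> 1" "v \<noteq> []"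
  shows "remove1 (Max (set v)) v = butlast v"
proof -
  obtain w l where v: "v = w @ [l]" using assms(3) by (cases v rule: rev_cases) auto
  have lt: "x < l" if "x \<in> set w" for x
    using assms(1,2) that unfolding v by (fastforce simp: t_spread_iff sorted_wrt_append)
  then have "Max (set v) = l" unfolding v by (intro Max_eqI) (auto intro: less_imp_le)
  moreover have "l \<notin> set w" using lt by blast
  ultimately show ?thesis by (simp add: v remove1_append)
qed

section \<open>The facets for a completely lexsegment ideal\<close>

lemma G_familyE:
  assumes "G \<in> G_family n d t u" "t \<ge> 1"
  obtains w where "G = cosupp_t t w \<union> {1}" "t_spread t (1 # w)" "length w = d - 1" "set w \<subseteq> {1..n}"
    "w >slex remove1 1 u" "1 \<notin> cosupp_t t w" "G \<subseteq> {1..n}" "card G = (d - 1) * t + 1"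
proof -
  obtain w where w: "G = cosupp_t t w \<union> {1}" "t_spread t (1 # w)" "length w = d - 1" "set w \<subseteq> {1..n}"
      "w >slex remove1 1 u" "1 \<le> n"
    using assms(1) by (auto simp: G_family_def M_def)
  have ge: "1 < z \<and> z \<le> n" if "z \<in> cosupp_t t w" for z
    using that w(2,4) assms(2) by (fastforce simp: cosupp_t_def)
  then have "1 \<notin> cosupp_t t w" "G \<subseteq> {1..n}" using w(1,6) by fastforce+
  moreover have "card G = (d - 1) * t + 1"
    using calculation w card_cosupp_t[of t w] assms(2) by (force simp: card_insert_if)
  ultimately show thesis using that w by blast
qed

lemma F_tildeE:
  assumes "F \<in> F_tilde n d t u v" "t \<ge> 1" "2 \<le> d" "t_spread t v" "length v = d"
  obtains w where "F = supp_t t w" "t_spread t w" "length w = d - 1" "w >slex butlast v"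
    "1 \<notin> supp_t t w \<and> remove1 1 u \<ge>slex shift t w \<or>
     1 \<in> supp_t t w \<and> (\<forall>j \<in> {1..n} - supp_t t w. supp_t t w \<union> {j} \<notin> G_family n d t u)"
    "F \<subseteq> {1..n}" "card F = (d - 1) * t"
proof -
  have bl: "remove1 (Max (set v)) v = butlast v"
    using assms by (intro remove1_Max_t_spread) auto
  obtain w where w: "F = supp_t t w" "t_spread t w" "length w = d - 1" "w >slex butlast v"
    "1 \<notin> supp_t t w \<and> remove1 1 u \<ge>slex shift t w \<or>
     1 \<in> supp_t t w \<and> (\<forall>j \<in> {1..n} - supp_t t w. supp_t t w \<union> {j} \<notin> G_family n d t u)"
    "set w \<subseteq> {1..n + 1 - t}"
    using assms(1) unfolding F_tilde_def bl M_def by blast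
  have "F \<subseteq> {1..n}" using w(1,6) assms(2) by (fastforce simp: supp_t_def)
  moreover have "card F = (d - 1) * t" using card_supp_t[of t w] w assms(2) by fastforce
  ultimately show thesis using that w(1-5) by blast
qed

locale lexsegment =
  fixes n t d :: nat and u v :: "nat list"
  assumes t: "t \<ge> 1" and d: "d \<ge> 2" and u: "u \<in> M n d t" and v: "v \<in> M n d t"
    and u0: "u ! 0 = 1" and v0: "v ! 0 \<ge> 2"
begin

text \<open>The complement of \<open>F_set t v p\<close> for \<open>p\<close> in
  \<open>{1..d}\<close>. As there, \<open>p\<close> counts from 1, hence the list position
  \<open>p - 1\<close>.\<close>

abbreviation "prefix_set p \<equiv> supp_t t (take (p - 1) v) \<union> {v ! (p - 1)<..n}"

lemma v_spread: "t_spread t v" "set v \<subseteq> {1..n}" "length v = d"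
  using v by (auto simp: M_def)

lemma u_Cons: "u = 1 # tl u" "remove1 1 u = tl u" "length (tl u) = d - 1"
proof -
  show "u = 1 # tl u" using u d u0 by (cases u) (auto simp: M_def)
  then show "remove1 1 u = tl u" by (metis remove1.simps(2))
  show "length (tl u) = d - 1" using u by (simp add: M_def)
qed

lemma pred_index_less: "p \<in> {1..d} \<Longrightarrow> p - 1 < length v"
  using v_spread(3) by auto

lemma prefix_set_complement:
  assumes "p \<in> {1..d}"
  shows "{1..n} - F_set t v p = prefix_set p" "F_set t v p \<subseteq> {1..n}"
  using F_set_complement[OF t v_spread(1,2) pred_index_less[OF assms]] assms by simp_all

lemma one_notin_prefix_set:
  assumes "p \<in> {1..d}"
  shows "1 \<notin> prefix_set p"
proof -
  have le: "2 \<le> x" if "x \<in> set v" for x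
    using that v_spread(1) v0 by (cases v) fastforce+
  moreover have "v ! (p - 1) \<in> set v" using assms v_spread(3) by (intro nth_mem) auto
  ultimately have "2 \<le> v ! (p - 1)" by blast
  moreover have "1 \<notin> supp_t t (take (p - 1) v)"
    using le by (fastforce simp: supp_t_def dest: in_set_takeD)
  ultimately show ?thesis by auto
qed

lemma card_prefix_set_ge:
  assumes "p \<in> {1..d}"
  shows "(d - 1) * t \<le> card (prefix_set p)"
  using card_prefix_set[OF t v_spread(1,2), of "p - 1"] assms v_spread(3) by auto

lemma I_set_iff:
  "p \<in> I_set n d t u v \<longleftrightarrow> p \<in> {1..d} \<and> \<not> (card (prefix_set p) = (d - 1) * t \<and>
     shift t (take (p - 1) v) @ drop p v >slex tl u)"
  unfolding I_set_def u_Cons(2) using prefix_set_complement(1)[of p] by auto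

section \<open>The facets and their incomparability\<close>

definition index_set :: "(nat set + nat + nat set) set" where
  "index_set = G_family n d t u <+> I_set n d t u v <+> F_tilde n d t u v"

text \<open>For a completely lexsegment ideal these turn out to be the facets of its Stanley-Reisner
  complex; the primes are generated by their complements.\<close>

definition facet :: "nat set + nat + nat set \<Rightarrow> nat set" where
  "facet = case_sum (\<lambda>G. G) (case_sum prefix_set (\<lambda>F. F))"

lemma index_set_cases:
  assumes "i \<in> index_set"
  obtains (G) G where "i = Inl G" "facet i = G" "G \<in> G_family n d t u"
  | (I) p where "i = Inr (Inl p)" "facet i = prefix_set p" "p \<in> I_set n d t u v" "p \<in> {1..d}"
  | (F) F where "i = Inr (Inr F)" "facet i = F" "F \<in> F_tilde n d t u v"
  using assms I_set_iff by (auto simp: index_set_def facet_def)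

lemmas F_tildeE' = F_tildeE[OF _ t d v_spread(1,3)]

text \<open>A spread list of length \<open>d\<close> inside a member of \<open>G_family\<close>
  would come before \<open>u\<close>, one inside a \<open>prefix_set\<close> would come after
  \<open>v\<close>, and \<open>d - 1\<close> blocks have no room for \<open>d\<close>
  entries.\<close>

lemma facet_is_face:
  assumes "i \<in> index_set" "w \<in> lexseg n d t u v"
  shows "\<not> set w \<subseteq> facet i"
proof
  assume sub: "set w \<subseteq> facet i"
  have w: "t_spread t w" "length w = d" "\<not> w >slex u" "\<not> v >slex w"
    using assms(2) slex_gt_iff_not_ge[of w u] slex_gt_iff_not_ge[of v w] u v
    by (auto simp: lexseg_def M_def)
  show False using assms(1)
  proof (cases rule: index_set_cases)
    case (G G)
    from G(3) t obtain z where z: "G = cosupp_t t z \<union> {1}" "t_spread t (1 # z)" "length z = d - 1"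
        "z >slex remove1 1 u"
      by (rule G_familyE)
    have "w \<ge>slex 1 # z" using slex_ge_if_subset_insert_cosupp_t[OF w(1) z(2) t] sub G z w d by auto
    moreover have "1 # z >slex 1 # tl u" using z(4) u_Cons(2) slex_gt_length[OF z(4)] by simp
    ultimately show False using slex_ge_gt_trans w(3) u_Cons(1) by metis
  next
    case (I p)
    then show False
      using slex_gt_if_subset_prefix_set[OF t v_spread(1) pred_index_less[OF I(4)] w(1)] w sub v_spread(3)
      by auto
  next
    case (F F)
    from F(3) obtain z where "F = supp_t t z" "t_spread t z" "length z = d - 1" by (rule F_tildeE')
    then show False using length_le_if_subset_supp_t[OF w(1) _ t, of z] sub F w d by auto
  qed
qed

text \<open>An inclusion would place the set in the \<open>d - 1\<close> blocks of \<open>z\<close>,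
  since it avoids 1, and so force its size to be \<open>(d - 1) * t\<close>. The shifted list
  \<open>c\<close> lies in these blocks too, so \<open>c\<close> is at least \<open>z\<close> and
  hence greater than \<open>u / x_1\<close>. Then \<open>p\<close> would have been removed from
  \<open>I_set\<close>.\<close>

lemma prefix_set_not_subset_G:
  assumes p: "p \<in> I_set n d t u v" "p \<in> {1..d}" and G: "G \<in> G_family n d t u"
  shows "\<not> prefix_set p \<subseteq> G"
proof
  assume sub: "prefix_set p \<subseteq> G"
  from G t obtain z where z: "G = cosupp_t t z \<union> {1}" "t_spread t (1 # z)" "length z = d - 1"
      "z >slex remove1 1 u" "1 \<notin> cosupp_t t z" "card G = (d - 1) * t + 1"
    by (rule G_familyE)
  define c where "c = shift t (take (p - 1) v) @ drop p v"
  have plt: "p - 1 < length v" "Suc (p - 1) = p" using p(2) v_spread(3) by auto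
  have c: "t_spread t c" "length c = d - 1" "cosupp_t t c \<subseteq> prefix_set p"
    using shifted_prefix[OF t v_spread(1,2) plt(1)] v_spread(3) unfolding plt(2) c_def by auto
  have sub': "prefix_set p \<subseteq> cosupp_t t z" using sub one_notin_prefix_set[OF p(2)] z(1) by blast
  then have "card (prefix_set p) \<le> card (cosupp_t t z)" by (intro card_mono) auto
  also have "\<dots> = (d - 1) * t" using z(1,5,6) by simp
  finally have "card (prefix_set p) = (d - 1) * t" using card_prefix_set_ge[OF p(2)] by simp
  moreover have "set c \<subseteq> cosupp_t t z" using set_subset_cosupp_t[of c t] c(3) sub' by blast
  then have "c \<ge>slex z" using slex_ge_if_subset_cosupp_t[of t c z] c z t by auto
  then have "c >slex tl u" using slex_ge_gt_trans z(4) u_Cons(2) by metis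
  ultimately show False using p by (simp add: I_set_iff c_def)
qed

text \<open>If 1 is not in \<open>F\<close>, the shifted list lies in the blocks of \<open>z\<close>
  and so exceeds \<open>u / x_1\<close>. If 1 is in \<open>F\<close>, then \<open>G\<close> has just
  one more element, so it is \<open>F\<close> with some \<open>j\<close> added. The definition of
  \<open>F_tilde\<close> excludes both.\<close>

lemma F_not_subset_G:
  assumes F: "F \<in> F_tilde n d t u v" and G: "G \<in> G_family n d t u"
  shows "\<not> F \<subseteq> G"
proof
  assume sub: "F \<subseteq> G"
  from G t obtain z where z: "G = cosupp_t t z \<union> {1}" "t_spread t (1 # z)" "length z = d - 1"
      "z >slex remove1 1 u" "1 \<notin> cosupp_t t z" "G \<subseteq> {1..n}" "card G = (d - 1) * t + 1"
    by (rule G_familyE)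
  from F obtain w where w: "F = supp_t t w" "t_spread t w" "length w = d - 1"
    "1 \<notin> supp_t t w \<and> remove1 1 u \<ge>slex shift t w \<or>
     1 \<in> supp_t t w \<and> (\<forall>j \<in> {1..n} - supp_t t w. supp_t t w \<union> {j} \<notin> G_family n d t u)"
    "card F = (d - 1) * t"
    by (rule F_tildeE')
  from w(4) show False
  proof (elim disjE conjE)
    assume "1 \<notin> supp_t t w" and le: "remove1 1 u \<ge>slex shift t w"
    then have "set (shift t w) \<subseteq> cosupp_t t z"
      using set_subset_cosupp_t[of "shift t w" t] sub w(1) z(1) by (auto simp: cosupp_t_shift)
    then have "shift t w \<ge>slex z"
      using slex_ge_if_subset_cosupp_t[of t "shift t w" z] t_spread_shift[OF w(2)] w(3) z t by auto
    then have "shift t w >slex remove1 1 u" using slex_ge_gt_trans z(4) by blast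
    then show False using le slex_gt_iff_not_ge[of "shift t w" "remove1 1 u"] slex_gt_length by blast
  next
    assume no: "\<forall>j \<in> {1..n} - supp_t t w. supp_t t w \<union> {j} \<notin> G_family n d t u"
    have fin: "finite G" using z(6) by (rule finite_subset) simp
    then have "card (G - F) = 1" using sub w(5) z(7) finite_subset by (subst card_Diff_subset) auto
    then obtain j where j: "G - F = {j}" by (rule card_1_singletonE)
    then have "G = supp_t t w \<union> {j}" "j \<in> {1..n} - supp_t t w" using sub w(1) z(6) by auto
    then show False using no G by auto
  qed
qed

lemma facet_antichain:
  assumes "i \<in> index_set" "j \<in> index_set" "facet i \<subseteq> facet j"
  shows "i = j"
  using assms(1)
proof (cases rule: index_set_cases)
  case G: (G G)
  from G(3) t have G1: "1 \<in> G" "card G = (d - 1) * t + 1" by (rule G_familyE, simp)+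
  from assms(2) show ?thesis
  proof (cases rule: index_set_cases)
    case (G G')
    from G(3) t have "card G' = (d - 1) * t + 1" "G' \<subseteq> {1..n}" by (rule G_familyE, simp)+
    moreover have "G \<subseteq> G'" using assms(3) G \<open>facet i = _\<close> by simp
    ultimately have "G = G'" using G1 finite_subset[of G' "{1..n}"] by (intro card_subset_eq) auto
    then show ?thesis using G \<open>i = _\<close> by simp
  next
    case (I p)
    then have "1 \<notin> facet j" using one_notin_prefix_set[OF I(4)] by simp
    then show ?thesis using G1 assms(3) G by blast
  next
    case (F F)
    from F(3) have "card F = (d - 1) * t" "F \<subseteq> {1..n}" by (rule F_tildeE', simp)+
    moreover have "card G \<le> card F"
      using assms(3) F G calculation by (intro card_mono) (auto intro: finite_subset)
    ultimately show ?thesis using G1 by simp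
  qed
next
  case p: (I p)
  from assms(2) show ?thesis
  proof (cases rule: index_set_cases)
    case (G G)
    then show ?thesis using prefix_set_not_subset_G p assms(3) by auto
  next
    case (I q)
    have "p - 1 = q - 1"
      using prefix_set_antichain[OF t v_spread(1,2), of "p - 1" "q - 1"] p I assms(3) v_spread(3) by auto
    then show ?thesis using p I by auto
  next
    case (F F)
    from F(3) obtain w where w: "F = supp_t t w" "t_spread t w" "w >slex butlast v" "card F = (d - 1) * t"
      by (rule F_tildeE')
    \<comment> \<open>By size the inclusion is an equality, so \<open>w\<close> itself lies in the
      \<open>prefix_set\<close>, against \<open>w >slex butlast v\<close>.\<close>
    have "prefix_set p = F"
      using card_prefix_set_ge[OF p(4)] w assms(3) p F by (intro card_seteq) auto
    then have "set w \<subseteq> prefix_set p" using set_subset_supp_t w by blast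
    then show ?thesis
      using not_slex_gt_if_subset_prefix_set[OF t v_spread(1) pred_index_less[OF p(4)] w(2)] w(3) by blast
  qed
next
  case F: (F F)
  from F(3) obtain w where w: "F = supp_t t w" "t_spread t w" "w >slex butlast v" "card F = (d - 1) * t"
    by (rule F_tildeE')
  from assms(2) show ?thesis
  proof (cases rule: index_set_cases)
    case (G G)
    then show ?thesis using F_not_subset_G F assms(3) by auto
  next
    case (I p)
    then have "set w \<subseteq> prefix_set p" using set_subset_supp_t w assms(3) F by blast
    then show ?thesis
      using not_slex_gt_if_subset_prefix_set[OF t v_spread(1) pred_index_less[OF I(4)] w(2)] w(3) by blast
  next
    case (F F')
    from F(3) have F': "card F' = (d - 1) * t" "F' \<subseteq> {1..n}" by (rule F_tildeE', simp)+
    have "F \<subseteq> F'" using assms(3) F \<open>facet i = _\<close> by simp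
    then have "F = F'" using F' w(4) finite_subset[of F' "{1..n}"] by (intro card_subset_eq) auto
    then show ?thesis using F \<open>i = _\<close> by simp
  qed
qed

section \<open>Every face lies in a facet\<close>

lemma initial_face_subset_facet:
  assumes S: "S \<subseteq> {1..n}" and face: "\<And>w. w \<in> initial_lexseg n d t v \<Longrightarrow> \<not> set w \<subseteq> S"
  shows "\<exists>i\<in>index_set. S \<subseteq> facet i"
proof -
  have "\<not> x \<ge>slex v" if "t_spread t x" "set x \<subseteq> S" for x
    using face[of x] that S slex_ge_length[of x v] v_spread(3) by (auto simp: initial_lexseg_def M_def)
  then consider p where "p < length v" "S \<subseteq> supp_t t (take p v) \<union> {v ! p<..n}"
    | w where "t_spread t w" "\<forall>l\<in>set w. 1 \<le> l \<and> l + t \<le> n + 1" "S \<subseteq> supp_t t w" "w >slex butlast v"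
    using initial_face_cover[OF t _ v_spread(1,2) S] v_spread(3) d by force
  then show ?thesis
  proof cases
    case (1 p)
    then have p: "Suc p \<in> {1..d}" "S \<subseteq> prefix_set (Suc p)" using v_spread(3) by auto
    define c where "c = shift t (take p v) @ drop (Suc p) v"
    show ?thesis
    proof (cases "Suc p \<in> I_set n d t u v")
      case True
      then show ?thesis using p by (intro bexI[of _ "Inr (Inl (Suc p))"]) (auto simp: index_set_def facet_def)
    next
      case False
      then have card: "card (prefix_set (Suc p)) = (d - 1) * t" and gt: "c >slex tl u"
        using p(1) by (auto simp: I_set_iff c_def)
      note c = shifted_prefix[OF t v_spread(1,2) 1(1), folded c_def]
      have tl: "\<forall>l\<in>set c. t \<le> l" using c(2) v0 by fastforce
      \<comment> \<open>For a removed index the inclusion from \<open>shifted_prefix\<close> is an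
        equality by counting, so adding 1 to the set gives the member of \<open>G_family\<close>
        attached to \<open>c\<close>.\<close>
      have "cosupp_t t c = prefix_set (Suc p)"
        using card c(4) card_cosupp_t[OF c(1) t tl] c(3) v_spread(3) by (intro card_subset_eq) auto
      moreover have "1 # c \<in> M n d t"
      proof -
        have "1 \<le> n" using nth_mem[OF 1(1)] v_spread(2) by auto
        moreover have "set c \<subseteq> {1..n}" using c(2) tl t by fastforce
        moreover have "length (1 # c) = d" using c(3) v_spread(3) d by simp
        ultimately show ?thesis using c(5)[OF v0] unfolding M_def by auto
      qed
      ultimately have "prefix_set (Suc p) \<union> {1} \<in> G_family n d t u"
        using gt u_Cons(2) unfolding G_family_def by auto
      then show ?thesis using p
        by (intro bexI[of _ "Inl (prefix_set (Suc p) \<union> {1})"]) (auto simp: index_set_def facet_def)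
    qed
  next
    case (2 w)
    have len: "length w = d - 1" using slex_gt_length[OF 2(4)] v_spread(3) by simp
    have wM: "w \<in> M (n + 1 - t) (d - 1) t" using 2 len by (fastforce simp: M_def)
    have bl: "remove1 (Max (set v)) v = butlast v"
      using v_spread d by (intro remove1_Max_t_spread[OF _ t]) auto
    show ?thesis
    proof (cases "supp_t t w \<in> F_tilde n d t u v")
      case True
      then show ?thesis using 2(3)
        by (intro bexI[of _ "Inr (Inr (supp_t t w))"]) (auto simp: index_set_def facet_def)
    next
      case False
      \<comment> \<open>\<open>F_tilde\<close> asks for some list with the given support, so
        non-membership refutes the condition for this \<open>w\<close> in particular.\<close>
      have no: "\<not> (1 \<notin> supp_t t w \<and> remove1 1 u \<ge>slex shift t w \<or>
         1 \<in> supp_t t w \<and> (\<forall>j \<in> {1..n} - supp_t t w. supp_t t w \<union> {j} \<notin> G_family n d t u))" (is "\<not> ?cond")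
      proof
        assume ?cond
        then have "supp_t t w \<in> F_tilde n d t u v"
          unfolding F_tilde_def bl using wM 2(4) by (intro CollectI exI[of _ w] conjI refl)
        with False show False ..
      qed
      have "\<exists>G\<in>G_family n d t u. supp_t t w \<subseteq> G"
      proof (cases "1 \<in> supp_t t w")
        case True
        then show ?thesis using no by blast
      next
        case False
        then have "\<not> remove1 1 u \<ge>slex shift t w" using no by blast
        then have gt: "shift t w >slex remove1 1 u"
          using slex_gt_iff_not_ge[of "shift t w" "remove1 1 u"] len u_Cons by simp
        \<comment> \<open>The entries of \<open>w\<close> are at least 2, so the shifted ones are at
          least \<open>1 + t\<close> and 1 may be put in front.\<close>
        have "l \<noteq> 1" if "l \<in> set w" for l using False set_subset_supp_t that by blast
        then have ge: "1 + t \<le> l \<and> l \<le> n" if "l \<in> set (shift t w)" for l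
          using that 2(2) t by (fastforce simp: shift_def)
        moreover have "1 \<le> n" using v_spread d by (cases v) auto
        ultimately have "1 # shift t w \<in> M n d t"
          using t_spread_shift[OF 2(1)] len d t by (fastforce simp: M_def)
        then have "cosupp_t t (shift t w) \<union> {1} \<in> G_family n d t u"
          using gt unfolding G_family_def by blast
        then show ?thesis unfolding cosupp_t_shift by blast
      qed
      then obtain G where "G \<in> G_family n d t u" "S \<subseteq> G" using 2(3) by blast
      then show ?thesis by (intro bexI[of _ "Inl G"]) (auto simp: index_set_def facet_def)
    qed
  qed
qed

text \<open>The list \<open>y\<close> only certifies that \<open>S\<close> contains a spread list of
  length \<open>d\<close>, so that the greedy choice from the right can start.\<close>

lemma final_face_subset_facet:
  assumes S: "S \<subseteq> {1..n}" and face: "\<And>w. w \<in> final_lexseg n d t u \<Longrightarrow> \<not> set w \<subseteq> S"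
    and y: "y \<in> M n d t" "set y \<subseteq> S"
  shows "\<exists>i\<in>index_set. S \<subseteq> facet i"
proof -
  have fin: "finite S" using S by (rule finite_subset) simp
  have "t_spread t y" "length y = Suc (d - 1)" using y(1) d by (auto simp: M_def)
  then obtain x w where xw: "t_spread t (x # w)" "length w = d - 1" "set (x # w) \<subseteq> S"
      "S \<subseteq> {..x} \<union> cosupp_t t w"
    using cosupp_t_cover[OF t fin _ _ y(2)] by blast
  have M: "x # w \<in> M n d t" using xw S d by (auto simp: M_def)
  then have "\<not> u \<ge>slex x # w" using face[of "x # w"] xw(3) by (auto simp: final_lexseg_def)
  then have "\<not> (1 # tl u \<ge>slex x # w)" using u_Cons(1) by metis
  moreover have "1 \<le> x" using xw(3) S by auto
  \<comment> \<open>As \<open>u\<close> starts with 1, a list with larger head would belong to the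
    final segment.\<close>
  ultimately have x: "x = 1" and "\<not> tl u \<ge>slex w" using xw(2) u_Cons(3) by auto
  then have "w >slex tl u" using slex_gt_iff_not_ge[of w "tl u"] xw(2) u_Cons(3) by simp
  then have "cosupp_t t w \<union> {1} \<in> G_family n d t u"
    using M x u_Cons(2) unfolding G_family_def by auto
  moreover have "S \<subseteq> cosupp_t t w \<union> {1}" using xw(4) x S by fastforce
  ultimately show ?thesis
    by (intro bexI[of _ "Inl (cosupp_t t w \<union> {1})"]) (auto simp: index_set_def facet_def)
qed

section \<open>From facets to the primary decomposition\<close>

lemma facet_subset:
  assumes "i \<in> index_set"
  shows "facet i \<subseteq> {1..n}"
  using assms
proof (cases rule: index_set_cases)
  case (G G)
  from G(3) t show ?thesis by (rule G_familyE) (use G in simp)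
next
  case (I p)
  then show ?thesis using prefix_set_complement(1)[of p] by blast
next
  case (F F)
  from F(3) show ?thesis by (rule F_tildeE') (use F in simp)
qed

lemma finite_index_set: "finite index_set"
proof -
  have "index_set \<subseteq> Pow {1..n} <+> {1..d} <+> Pow {1..n}"
  proof
    fix i assume i: "i \<in> index_set"
    then show "i \<in> Pow {1..n} <+> {1..d} <+> Pow {1..n}"
      by (cases rule: index_set_cases) (use facet_subset[OF i] in auto)
  qed
  then show ?thesis by (rule finite_subset) simp
qed

lemma M_distinct: "w \<in> M n d t \<Longrightarrow> distinct w \<and> set w \<subseteq> {1..n}"
  using t_spread_distinct t by (auto simp: M_def)

lemma standard_primary_decomposition_lexseg:
  fixes I :: "'k::field mpolynomial set"
  assumes "completely_lexsegment_ideal n d t u v I"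
  shows "standard_primary_decomposition (poly_ring n) I index_set
    (\<lambda>i. var_prime n ({1..n} - facet i))"
proof -
  have I: "I = ideal_of n (lexseg n d t u v)"
    and eq: "(ideal_of n (lexseg n d t u v) :: 'k mpolynomial set) =
      ideal_of n (initial_lexseg n d t v) \<inter> ideal_of n (final_lexseg n d t u)"
    using assms by (auto simp: completely_lexsegment_ideal_def)
  show ?thesis unfolding I
  proof (rule standard_primary_decomposition_var_prime[OF finite_index_set])
    fix w assume "w \<in> lexseg n d t u v"
    then have w: "w \<in> lexseg n d t u v" "w \<in> M n d t" by (auto simp: lexseg_def)
    show "distinct w \<and> set w \<subseteq> {1..n}" by (rule M_distinct[OF w(2)])
    fix i assume "i \<in> index_set"
    then show "set w \<inter> ({1..n} - facet i) \<noteq> {}" using facet_is_face w M_distinct[OF w(2)] by blast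
  next
    fix i j assume ij: "i \<in> index_set" "j \<in> index_set" "{1..n} - facet i \<subseteq> {1..n} - facet j"
    then have "facet j \<subseteq> facet i" using facet_subset by blast
    then show "i = j" using facet_antichain ij by blast
  next
    fix S assume S: "S \<subseteq> {1..n}" and face: "\<And>w. w \<in> lexseg n d t u v \<Longrightarrow> \<not> set w \<subseteq> S"
    have "\<exists>i\<in>index_set. S \<subseteq> facet i"
    proof (cases "\<exists>y \<in> initial_lexseg n d t v. set y \<subseteq> S")
      case False
      then show ?thesis using initial_face_subset_facet[OF S] by blast
    next
      case True
      then obtain y where y: "y \<in> initial_lexseg n d t v" "set y \<subseteq> S" by blast
      \<comment> \<open>Complete lexsegmentness enters here: \<open>y\<close> and \<open>w\<close>
        in \<open>S\<close> together would give a list of the segment itself in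
        \<open>S\<close>.\<close>
      have "\<not> set w \<subseteq> S" if w: "w \<in> final_lexseg n d t u" for w
      proof
        assume "set w \<subseteq> S"
        then have "\<exists>w\<in>lexseg n d t u v. set w \<subseteq> S"
          using y w M_distinct by (intro ideal_of_Int_support[OF _ eq S, of y w])
            (simp_all add: initial_lexseg_def final_lexseg_def lexseg_def, blast)
        then show False using face by blast
      qed
      moreover have "y \<in> M n d t" using y by (simp add: initial_lexseg_def)
      ultimately show ?thesis using final_face_subset_facet[OF S] y(2) by blast
    qed
    then show "\<exists>i\<in>index_set. S \<inter> ({1..n} - facet i) = {}" by blast
  qed auto
qed

lemma components_eq:
  assumes "i \<in> index_set"
  shows "case_sum (\<lambda>G. var_prime n ({1..n} - G))
      (case_sum (\<lambda>p. var_prime n (F_set t v p)) (\<lambda>F. var_prime n ({1..n} - F))) i =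
    var_prime n ({1..n} - facet i)"
  using assms
proof (cases rule: index_set_cases)
  case (I p)
  then have "F_set t v p = {1..n} - facet i" using prefix_set_complement[of p] by blast
  then show ?thesis using I(1) by simp
qed auto

end

lemma standard_primary_decomposition_cong:
  assumes "\<And>i. i \<in> J \<Longrightarrow> Q i = Q' i"
  shows "standard_primary_decomposition R I J Q \<longleftrightarrow> standard_primary_decomposition R I J Q'"
proof -
  have "family_Inter R K Q = family_Inter R K Q'" if "K \<subseteq> J" for K
    using assms that by (auto simp: family_Inter_def)
  moreover have "inj_on (\<lambda>i. radical_of R (Q i)) J \<longleftrightarrow> inj_on (\<lambda>i. radical_of R (Q' i)) J"
    by (rule inj_on_cong) (simp add: assms)
  moreover have "Q ` J = Q' ` J" using assms by (rule image_cong[OF refl])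
  ultimately show ?thesis
    using assms by (simp add: standard_primary_decomposition_def minimal_primary_decomposition_def)
qed

theorem theorem2p12:
  fixes n t d :: nat and u v :: "nat list" and I :: "'k::field mpolynomial set"
  assumes "n \<ge> 1" and "t \<ge> 1" and "d \<ge> 2"
    and "u \<in> M n d t" and "v \<in> M n d t"
    and "u ! 0 = 1" and "v ! 0 \<ge> 2"
    and "completely_lexsegment_ideal n d t u v I"
    and "I \<noteq> veronese_ideal n d t"
  shows "standard_primary_decomposition (poly_ring n) I
    (G_family n d t u <+> I_set n d t u v <+> F_tilde n d t u v)
    (case_sum (\<lambda>G. var_prime n ({1..n} - G))
      (case_sum (\<lambda>p. var_prime n (F_set t v p))
        (\<lambda>F. var_prime n ({1..n} - F))))"
proof -
  interpret lexsegment n t d u v using assms by unfold_locales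
  show ?thesis unfolding index_set_def[symmetric]
    by (rule iffD2[OF standard_primary_decomposition_cong[OF components_eq]
          standard_primary_decomposition_lexseg[OF assms(8)]])
qed

end
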